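(* Let $R\subset S$ be a subintegral FCP extension. Then $R\subset S$ is distributive if and only if $R\subset S$ is arithmetic.
   Context: All rings are commutative with unit. $[R,S]$ denotes the set of all $R$-subalgebras of $S$, ordered by inclusion; it is a lattice in which the infimum of $T,U$ is $T\cap U$ and the supremum is the compositum $TU$. The extension $R\subseteq S$ is called distributive if the lattice $[R,S]$ is distributive. It has FCP if every chain in $[R,S]$ is finite. An integral extension $R\subseteq S$ is called subintegral if the natural map $\mathrm{Spec}(S)\to\mathrm{Spec}(R)$ is bijective and, for every $Q\in\mathrm{Spec}(S)$ with $P:=Q\cap R$, the residual extension $\kappa_R(P)\to\kappa_S(Q)$ is an isomorphism, where $\kappa_R(P):=R_P/PR_P$. For $P\in\mathrm{Spec}(R)$, $S_P$ denotes the localization of $S$ at the multiplicative set $R\setminus P$. The extension $R\subseteq S$ is called arithmetic if $[R_P,S_P]$ is a chain (totally ordered by inclusion) for each $P\in\mathrm{Spec}(R)$. *)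

theory Defs
  imports "HOL-Algebra.Algebra"
begin

section \<open>Localization of a commutative ring at a multiplicative set\<close>

definition fraction_rel ::
  "('a, 'm) ring_scheme \<Rightarrow> 'a set \<Rightarrow> (('a \<times> 'a) \<times> ('a \<times> 'a)) set" where
  "fraction_rel A M =
     {((a, s), (b, t)). a \<in> carrier A \<and> s \<in> M \<and> b \<in> carrier A \<and> t \<in> M \<and>
        (\<exists>u\<in>M. u \<otimes>\<^bsub>A\<^esub> (a \<otimes>\<^bsub>A\<^esub> t) = u \<otimes>\<^bsub>A\<^esub> (b \<otimes>\<^bsub>A\<^esub> s))}"

definition fraction :: "('a, 'm) ring_scheme \<Rightarrow> 'a set \<Rightarrow> 'a \<Rightarrow> 'a \<Rightarrow> ('a \<times> 'a) set" where
  "fraction A M a s = fraction_rel A M `` {(a, s)}"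

(* The operations pick out the single fraction produced by all choices of representatives;
   fraction_mult and fraction_add below give the usual formulas. *)
definition localization :: "('a, 'm) ring_scheme \<Rightarrow> 'a set \<Rightarrow> ('a \<times> 'a) set ring" where
  "localization A M =
     \<lparr>carrier = (carrier A \<times> M) // fraction_rel A M,
      monoid.mult = (\<lambda>F G. the_elem (\<Union>(a, s)\<in>F. \<Union>(b, t)\<in>G.
                {fraction A M (a \<otimes>\<^bsub>A\<^esub> b) (s \<otimes>\<^bsub>A\<^esub> t)})),
      one = fraction A M \<one>\<^bsub>A\<^esub> \<one>\<^bsub>A\<^esub>,
      ring.zero = fraction A M \<zero>\<^bsub>A\<^esub> \<one>\<^bsub>A\<^esub>,
      ring.add = (\<lambda>F G. the_elem (\<Union>(a, s)\<in>F. \<Union>(b, t)\<in>G.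
                {fraction A M ((a \<otimes>\<^bsub>A\<^esub> t) \<oplus>\<^bsub>A\<^esub> (b \<otimes>\<^bsub>A\<^esub> s)) (s \<otimes>\<^bsub>A\<^esub> t)}))\<rparr>"

(* For a subring A of B and multiplicative sets M \<subseteq> N of A and B, the canonical map from
   localization A M to localization B N, sending a/s to a/s. *)
definition loc_map ::
  "('a, 'm) ring_scheme \<Rightarrow> 'a set \<Rightarrow> ('a \<times> 'a) set \<Rightarrow> ('a \<times> 'a) set" where
  "loc_map B N F = the_elem ((\<lambda>(a, s). fraction B N a s) ` F)"

section \<open>Prime spectra and residue fields\<close>

definition Spec :: "('a, 'm) ring_scheme \<Rightarrow> 'a set set" where
  "Spec A = {P. primeideal P A}"

definition local_ring_at :: "('a, 'm) ring_scheme \<Rightarrow> 'a set \<Rightarrow> ('a \<times> 'a) set ring" where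
  "local_ring_at A P = localization A (carrier A - P)"

(* The extended ideal P A_P *)
definition ext_prime :: "('a, 'm) ring_scheme \<Rightarrow> 'a set \<Rightarrow> ('a \<times> 'a) set set" where
  "ext_prime A P =
     Idl\<^bsub>local_ring_at A P\<^esub> ((\<lambda>a. fraction A (carrier A - P) a \<one>\<^bsub>A\<^esub>) ` P)"

definition residue_field :: "('a, 'm) ring_scheme \<Rightarrow> 'a set \<Rightarrow> ('a \<times> 'a) set set ring" where
  "residue_field A P = local_ring_at A P Quot ext_prime A P"

section \<open>Ring extensions\<close>

text \<open>A ring extension is given by a commutative ring \<open>S\<close> and a subring, represented by its
  underlying set \<open>R\<close>.\<close>

abbreviation sub_as_ring :: "('a, 'm) ring_scheme \<Rightarrow> 'a set \<Rightarrow> ('a, 'm) ring_scheme" where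
  "sub_as_ring S R \<equiv> S\<lparr>carrier := R\<rparr>"

definition intermediate_rings :: "('a, 'm) ring_scheme \<Rightarrow> 'a set \<Rightarrow> 'a set set" where
  "intermediate_rings S R = {T. subring T S \<and> R \<subseteq> T}"

definition compositum :: "('a, 'm) ring_scheme \<Rightarrow> 'a set \<Rightarrow> 'a set \<Rightarrow> 'a set" where
  "compositum S T U = generate_ring S (T \<union> U)"

definition distributive_extension :: "('a, 'm) ring_scheme \<Rightarrow> 'a set \<Rightarrow> bool" where
  "distributive_extension S R \<longleftrightarrow>
     (\<forall>T\<in>intermediate_rings S R. \<forall>U\<in>intermediate_rings S R. \<forall>V\<in>intermediate_rings S R.
        T \<inter> compositum S U V = compositum S (T \<inter> U) (T \<inter> V))"

definition FCP_extension :: "('a, 'm) ring_scheme \<Rightarrow> 'a set \<Rightarrow> bool" where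
  "FCP_extension S R \<longleftrightarrow>
     (\<forall>\<C>. subset.chain (intermediate_rings S R) \<C> \<longrightarrow> finite \<C>)"

(* Polynomials are coefficient lists with the leading coefficient first. *)
definition integral_extension :: "('a, 'm) ring_scheme \<Rightarrow> 'a set \<Rightarrow> bool" where
  "integral_extension S R \<longleftrightarrow>
     (\<forall>x\<in>carrier S. \<exists>p. p \<noteq> [] \<and> hd p = \<one>\<^bsub>S\<^esub> \<and> set p \<subseteq> R \<and> ring.eval S p x = \<zero>\<^bsub>S\<^esub>)"

(* The map from the residue field of R at Q \<inter> R to that of S at Q, induced on cosets by
   the canonical map of local rings. *)
definition residual_map ::
  "('a, 'm) ring_scheme \<Rightarrow> 'a set \<Rightarrow> ('a \<times> 'a) set set \<Rightarrow> ('a \<times> 'a) set set" where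
  "residual_map S Q C =
     the_elem ((\<lambda>x. ext_prime S Q +>\<^bsub>local_ring_at S Q\<^esub> loc_map S (carrier S - Q) x) ` C)"

definition subintegral_extension :: "('a, 'm) ring_scheme \<Rightarrow> 'a set \<Rightarrow> bool" where
  "subintegral_extension S R \<longleftrightarrow>
     integral_extension S R \<and>
     bij_betw (\<lambda>Q. Q \<inter> R) (Spec S) (Spec (sub_as_ring S R)) \<and>
     (\<forall>Q\<in>Spec S. residual_map S Q
        \<in> ring_iso (residue_field (sub_as_ring S R) (Q \<inter> R)) (residue_field S Q))"

(* R_P is identified with its image in S_P under the canonical map, which is injective. *)
definition arithmetic_extension :: "('a, 'm) ring_scheme \<Rightarrow> 'a set \<Rightarrow> bool" where
  "arithmetic_extension S R \<longleftrightarrow>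
     (\<forall>P\<in>Spec (sub_as_ring S R).
        let S\<^sub>P = localization S (R - P);
            R\<^sub>P = loc_map S (R - P) ` carrier (local_ring_at (sub_as_ring S R) P)
        in subset.chain (intermediate_rings S\<^sub>P R\<^sub>P) (intermediate_rings S\<^sub>P R\<^sub>P))"

section \<open>Well-definedness\<close>

lemma equiv_fraction_rel:
  assumes "cring A" and "submonoid M A"
  shows "equiv (carrier A \<times> M) (fraction_rel A M)"
proof -
  interpret cring A by fact
  interpret M: submonoid M A by fact
  have M: "\<And>x. x \<in> M \<Longrightarrow> x \<in> carrier A" using M.subset by blast
  show ?thesis
  proof (rule equivI)
    show "fraction_rel A M \<subseteq> (carrier A \<times> M) \<times> (carrier A \<times> M)"
      unfolding fraction_rel_def by auto
    show "refl_on (carrier A \<times> M) (fraction_rel A M)"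
      unfolding refl_on_def fraction_rel_def using M.one_closed by auto
    show "sym (fraction_rel A M)"
      unfolding fraction_rel_def by (rule symI, clarsimp) metis
    show "trans (fraction_rel A M)"
    proof (rule transI)
      fix x y z assume "(x, y) \<in> fraction_rel A M" "(y, z) \<in> fraction_rel A M"
      then obtain a s b t c r u v where
        xyz: "x = (a, s)" "y = (b, t)" "z = (c, r)" and
        car: "a \<in> carrier A" "b \<in> carrier A" "c \<in> carrier A" and
        m: "s \<in> M" "t \<in> M" "r \<in> M" "u \<in> M" "v \<in> M" and
        e1: "u \<otimes>\<^bsub>A\<^esub> (a \<otimes>\<^bsub>A\<^esub> t) = u \<otimes>\<^bsub>A\<^esub> (b \<otimes>\<^bsub>A\<^esub> s)" and
        e2: "v \<otimes>\<^bsub>A\<^esub> (b \<otimes>\<^bsub>A\<^esub> r) = v \<otimes>\<^bsub>A\<^esub> (c \<otimes>\<^bsub>A\<^esub> t)"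
        unfolding fraction_rel_def by auto
      note mc = m[THEN M]
      have "(u \<otimes>\<^bsub>A\<^esub> v \<otimes>\<^bsub>A\<^esub> t) \<otimes>\<^bsub>A\<^esub> (a \<otimes>\<^bsub>A\<^esub> r) = (u \<otimes>\<^bsub>A\<^esub> (a \<otimes>\<^bsub>A\<^esub> t)) \<otimes>\<^bsub>A\<^esub> (v \<otimes>\<^bsub>A\<^esub> r)"
        using car mc by algebra
      also have "\<dots> = (v \<otimes>\<^bsub>A\<^esub> (b \<otimes>\<^bsub>A\<^esub> r)) \<otimes>\<^bsub>A\<^esub> (u \<otimes>\<^bsub>A\<^esub> s)"
        unfolding e1 using car mc by algebra
      also have "\<dots> = (u \<otimes>\<^bsub>A\<^esub> v \<otimes>\<^bsub>A\<^esub> t) \<otimes>\<^bsub>A\<^esub> (c \<otimes>\<^bsub>A\<^esub> s)"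
        unfolding e2 using car mc by algebra
      finally have "\<exists>w\<in>M. w \<otimes>\<^bsub>A\<^esub> (a \<otimes>\<^bsub>A\<^esub> r) = w \<otimes>\<^bsub>A\<^esub> (c \<otimes>\<^bsub>A\<^esub> s)"
        using m by (intro bexI[of _ "u \<otimes>\<^bsub>A\<^esub> v \<otimes>\<^bsub>A\<^esub> t"]) auto
      then show "(x, z) \<in> fraction_rel A M"
        unfolding fraction_rel_def xyz using car m by auto
    qed
  qed
qed

lemma fraction_eqI:
  assumes "cring A" and "submonoid M A" and "((a, s), (b, t)) \<in> fraction_rel A M"
  shows "fraction A M a s = fraction A M b t"
  unfolding fraction_def using equiv_class_eq[OF equiv_fraction_rel[OF assms(1,2)] assms(3)] .

lemma fraction_self:
  assumes "cring A" and "submonoid M A" and "a \<in> carrier A" and "s \<in> M"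
  shows "(a, s) \<in> fraction A M a s"
  unfolding fraction_def
  using equiv_class_self[OF equiv_fraction_rel[OF assms(1,2)]] assms(3,4) by auto

lemma fraction_mult:
  assumes "cring A" and "submonoid M A"
    and "a \<in> carrier A" "s \<in> M" "b \<in> carrier A" "t \<in> M"
  shows "fraction A M a s \<otimes>\<^bsub>localization A M\<^esub> fraction A M b t
    = fraction A M (a \<otimes>\<^bsub>A\<^esub> b) (s \<otimes>\<^bsub>A\<^esub> t)"
proof -
  interpret cring A by fact
  interpret M: submonoid M A by fact
  have M: "\<And>x. x \<in> M \<Longrightarrow> x \<in> carrier A" using M.subset by blast
  have "fraction A M (a' \<otimes>\<^bsub>A\<^esub> b') (s' \<otimes>\<^bsub>A\<^esub> t') = fraction A M (a \<otimes>\<^bsub>A\<^esub> b) (s \<otimes>\<^bsub>A\<^esub> t)"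
    if "(a', s') \<in> fraction A M a s" "(b', t') \<in> fraction A M b t" for a' s' b' t'
  proof (rule fraction_eqI[OF assms(1,2)])
    from that obtain u v where
      c: "a' \<in> carrier A" "b' \<in> carrier A" and m: "s' \<in> M" "t' \<in> M" "u \<in> M" "v \<in> M" and
      e1: "u \<otimes>\<^bsub>A\<^esub> (a \<otimes>\<^bsub>A\<^esub> s') = u \<otimes>\<^bsub>A\<^esub> (a' \<otimes>\<^bsub>A\<^esub> s)" and
      e2: "v \<otimes>\<^bsub>A\<^esub> (b \<otimes>\<^bsub>A\<^esub> t') = v \<otimes>\<^bsub>A\<^esub> (b' \<otimes>\<^bsub>A\<^esub> t)"
      unfolding fraction_def fraction_rel_def by auto
    note mc = m[THEN M] assms(4,6)[THEN M]
    have "(u \<otimes>\<^bsub>A\<^esub> v) \<otimes>\<^bsub>A\<^esub> ((a' \<otimes>\<^bsub>A\<^esub> b') \<otimes>\<^bsub>A\<^esub> (s \<otimes>\<^bsub>A\<^esub> t))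
        = (u \<otimes>\<^bsub>A\<^esub> (a' \<otimes>\<^bsub>A\<^esub> s)) \<otimes>\<^bsub>A\<^esub> (v \<otimes>\<^bsub>A\<^esub> (b' \<otimes>\<^bsub>A\<^esub> t))"
      using c mc assms(3,5) by algebra
    also have "\<dots> = (u \<otimes>\<^bsub>A\<^esub> v) \<otimes>\<^bsub>A\<^esub> ((a \<otimes>\<^bsub>A\<^esub> b) \<otimes>\<^bsub>A\<^esub> (s' \<otimes>\<^bsub>A\<^esub> t'))"
      unfolding e1[symmetric] e2[symmetric] using c mc assms(3,5) by algebra
    finally have "\<exists>w\<in>M. w \<otimes>\<^bsub>A\<^esub> ((a' \<otimes>\<^bsub>A\<^esub> b') \<otimes>\<^bsub>A\<^esub> (s \<otimes>\<^bsub>A\<^esub> t))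
        = w \<otimes>\<^bsub>A\<^esub> ((a \<otimes>\<^bsub>A\<^esub> b) \<otimes>\<^bsub>A\<^esub> (s' \<otimes>\<^bsub>A\<^esub> t'))"
      using m by (intro bexI[of _ "u \<otimes>\<^bsub>A\<^esub> v"]) auto
    then show "((a' \<otimes>\<^bsub>A\<^esub> b', s' \<otimes>\<^bsub>A\<^esub> t'), (a \<otimes>\<^bsub>A\<^esub> b, s \<otimes>\<^bsub>A\<^esub> t)) \<in> fraction_rel A M"
      unfolding fraction_rel_def using c m assms(3-6) by auto
  qed
  then have "(\<Union>(a', s')\<in>fraction A M a s. \<Union>(b', t')\<in>fraction A M b t.
      {fraction A M (a' \<otimes>\<^bsub>A\<^esub> b') (s' \<otimes>\<^bsub>A\<^esub> t')}) = {fraction A M (a \<otimes>\<^bsub>A\<^esub> b) (s \<otimes>\<^bsub>A\<^esub> t)}"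
    using fraction_self[OF assms(1,2,3,4)] fraction_self[OF assms(1,2,5,6)] by fast
  then show ?thesis by (simp add: localization_def)
qed

lemma fraction_add:
  assumes "cring A" and "submonoid M A"
    and "a \<in> carrier A" "s \<in> M" "b \<in> carrier A" "t \<in> M"
  shows "fraction A M a s \<oplus>\<^bsub>localization A M\<^esub> fraction A M b t
    = fraction A M ((a \<otimes>\<^bsub>A\<^esub> t) \<oplus>\<^bsub>A\<^esub> (b \<otimes>\<^bsub>A\<^esub> s)) (s \<otimes>\<^bsub>A\<^esub> t)"
proof -
  interpret cring A by fact
  interpret M: submonoid M A by fact
  have M: "\<And>x. x \<in> M \<Longrightarrow> x \<in> carrier A" using M.subset by blast
  have "fraction A M ((a' \<otimes>\<^bsub>A\<^esub> t') \<oplus>\<^bsub>A\<^esub> (b' \<otimes>\<^bsub>A\<^esub> s')) (s' \<otimes>\<^bsub>A\<^esub> t')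
      = fraction A M ((a \<otimes>\<^bsub>A\<^esub> t) \<oplus>\<^bsub>A\<^esub> (b \<otimes>\<^bsub>A\<^esub> s)) (s \<otimes>\<^bsub>A\<^esub> t)"
    if "(a', s') \<in> fraction A M a s" "(b', t') \<in> fraction A M b t" for a' s' b' t'
  proof (rule fraction_eqI[OF assms(1,2)])
    from that obtain u v where
      c: "a' \<in> carrier A" "b' \<in> carrier A" and m: "s' \<in> M" "t' \<in> M" "u \<in> M" "v \<in> M" and
      e1: "u \<otimes>\<^bsub>A\<^esub> (a \<otimes>\<^bsub>A\<^esub> s') = u \<otimes>\<^bsub>A\<^esub> (a' \<otimes>\<^bsub>A\<^esub> s)" and
      e2: "v \<otimes>\<^bsub>A\<^esub> (b \<otimes>\<^bsub>A\<^esub> t') = v \<otimes>\<^bsub>A\<^esub> (b' \<otimes>\<^bsub>A\<^esub> t)"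
      unfolding fraction_def fraction_rel_def by auto
    note mc = m[THEN M] assms(4,6)[THEN M]
    have "(u \<otimes>\<^bsub>A\<^esub> v) \<otimes>\<^bsub>A\<^esub> (((a' \<otimes>\<^bsub>A\<^esub> t') \<oplus>\<^bsub>A\<^esub> (b' \<otimes>\<^bsub>A\<^esub> s')) \<otimes>\<^bsub>A\<^esub> (s \<otimes>\<^bsub>A\<^esub> t))
        = ((u \<otimes>\<^bsub>A\<^esub> (a' \<otimes>\<^bsub>A\<^esub> s)) \<otimes>\<^bsub>A\<^esub> (v \<otimes>\<^bsub>A\<^esub> t' \<otimes>\<^bsub>A\<^esub> t))
          \<oplus>\<^bsub>A\<^esub> ((v \<otimes>\<^bsub>A\<^esub> (b' \<otimes>\<^bsub>A\<^esub> t)) \<otimes>\<^bsub>A\<^esub> (u \<otimes>\<^bsub>A\<^esub> s' \<otimes>\<^bsub>A\<^esub> s))"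
      using c mc assms(3,5) by algebra
    also have "\<dots> = (u \<otimes>\<^bsub>A\<^esub> v) \<otimes>\<^bsub>A\<^esub>
        (((a \<otimes>\<^bsub>A\<^esub> t) \<oplus>\<^bsub>A\<^esub> (b \<otimes>\<^bsub>A\<^esub> s)) \<otimes>\<^bsub>A\<^esub> (s' \<otimes>\<^bsub>A\<^esub> t'))"
      unfolding e1[symmetric] e2[symmetric] using c mc assms(3,5) by algebra
    finally have "\<exists>w\<in>M. w \<otimes>\<^bsub>A\<^esub> (((a' \<otimes>\<^bsub>A\<^esub> t') \<oplus>\<^bsub>A\<^esub> (b' \<otimes>\<^bsub>A\<^esub> s')) \<otimes>\<^bsub>A\<^esub> (s \<otimes>\<^bsub>A\<^esub> t))
        = w \<otimes>\<^bsub>A\<^esub> (((a \<otimes>\<^bsub>A\<^esub> t) \<oplus>\<^bsub>A\<^esub> (b \<otimes>\<^bsub>A\<^esub> s)) \<otimes>\<^bsub>A\<^esub> (s' \<otimes>\<^bsub>A\<^esub> t'))"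
      using m by (intro bexI[of _ "u \<otimes>\<^bsub>A\<^esub> v"]) auto
    then show "(((a' \<otimes>\<^bsub>A\<^esub> t') \<oplus>\<^bsub>A\<^esub> (b' \<otimes>\<^bsub>A\<^esub> s'), s' \<otimes>\<^bsub>A\<^esub> t'),
        ((a \<otimes>\<^bsub>A\<^esub> t) \<oplus>\<^bsub>A\<^esub> (b \<otimes>\<^bsub>A\<^esub> s), s \<otimes>\<^bsub>A\<^esub> t)) \<in> fraction_rel A M"
      unfolding fraction_rel_def using c m mc assms(3-6) by auto
  qed
  then have "(\<Union>(a', s')\<in>fraction A M a s. \<Union>(b', t')\<in>fraction A M b t.
      {fraction A M ((a' \<otimes>\<^bsub>A\<^esub> t') \<oplus>\<^bsub>A\<^esub> (b' \<otimes>\<^bsub>A\<^esub> s')) (s' \<otimes>\<^bsub>A\<^esub> t')})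
      = {fraction A M ((a \<otimes>\<^bsub>A\<^esub> t) \<oplus>\<^bsub>A\<^esub> (b \<otimes>\<^bsub>A\<^esub> s)) (s \<otimes>\<^bsub>A\<^esub> t)}"
    using fraction_self[OF assms(1,2,3,4)] fraction_self[OF assms(1,2,5,6)] by fast
  then show ?thesis by (simp add: localization_def)
qed

lemma loc_map_fraction:
  assumes "cring B" and "subring A B" and "submonoid N B" and "M \<subseteq> N" and "M \<subseteq> A"
    and "submonoid M (sub_as_ring B A)" and "a \<in> A" and "s \<in> M"
  shows "loc_map B N (fraction (sub_as_ring B A) M a s) = fraction B N a s"
proof -
  have A: "cring (sub_as_ring B A)" "A \<subseteq> carrier B"
    using ring.subcring_iff[OF cring.axioms(1)] cring.subcringI' subringE(1) assms(1,2) by blast+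
  have eq: "fraction B N b t = fraction B N a s" if "(b, t) \<in> fraction (sub_as_ring B A) M a s" for b t
  proof (rule fraction_eqI[OF assms(1,3)])
    from that obtain u where "b \<in> A" "t \<in> M" "u \<in> M"
      "u \<otimes>\<^bsub>B\<^esub> (a \<otimes>\<^bsub>B\<^esub> t) = u \<otimes>\<^bsub>B\<^esub> (b \<otimes>\<^bsub>B\<^esub> s)"
      unfolding fraction_def fraction_rel_def by auto
    then show "((b, t), (a, s)) \<in> fraction_rel B N"
      using A(2) assms(4,7,8) unfolding fraction_rel_def by (auto intro!: bexI[of _ u])
  qed
  have mem: "(a, s) \<in> fraction (sub_as_ring B A) M a s"
    using fraction_self[OF A(1) assms(6)] assms(7,8) by simp
  have "(\<lambda>(b, t). fraction B N b t) ` fraction (sub_as_ring B A) M a s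
      = (\<lambda>_. fraction B N a s) ` fraction (sub_as_ring B A) M a s"
    by (rule image_cong[OF refl]) (clarsimp simp: eq)
  also have "\<dots> = {fraction B N a s}"
    using mem by (simp only: image_constant)
  finally show ?thesis by (simp only: loc_map_def the_elem_eq)
qed

lemma compositum_is_supremum:
  assumes "ring S" and "T \<in> intermediate_rings S R" and "U \<in> intermediate_rings S R"
  shows "compositum S T U \<in> intermediate_rings S R"
    and "T \<subseteq> compositum S T U" and "U \<subseteq> compositum S T U"
    and "\<And>V. \<lbrakk>V \<in> intermediate_rings S R; T \<subseteq> V; U \<subseteq> V\<rbrakk> \<Longrightarrow> compositum S T U \<subseteq> V"
proof -
  interpret ring S by fact
  have sub: "T \<union> U \<subseteq> carrier S"
    using assms(2,3) subringE(1) unfolding intermediate_rings_def by blast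
  show T: "T \<subseteq> compositum S T U" and "U \<subseteq> compositum S T U"
    unfolding compositum_def by (auto intro: generate_ring.incl)
  show "compositum S T U \<in> intermediate_rings S R"
    using T assms(2) generate_ring_is_subring[OF sub]
    unfolding intermediate_rings_def compositum_def by auto
  show "compositum S T U \<subseteq> V"
    if "V \<in> intermediate_rings S R" "T \<subseteq> V" "U \<subseteq> V" for V
    using generate_ring_min_subring1[OF sub, of V] that
    unfolding intermediate_rings_def compositum_def by auto
qed

end

theory Submission
  imports Defs
begin

text \<open>
The whole argument takes place in \<open>S\<close>. For a prime \<open>P\<close> of \<open>R\<close> call a ring \<open>T\<close> between \<open>R\<close> and \<open>S\<close>
saturated at \<open>P\<close> if \<open>sx \<in> T\<close> with \<open>s \<in> R - P\<close> implies \<open>x \<in> T\<close>. These rings correspond to the rings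
between \<open>R\<^sub>P\<close> and \<open>S\<^sub>P\<close>, so \<open>R \<subseteq> S\<close> is arithmetic if and only if, for every \<open>P\<close>, any two of them are
comparable (\<open>arithmetic_extension_iff_saturated\<close>).

Chains are distributive, and distributivity is a local property: a failure \<open>x \<in> T \<inter> UV\<close>,
\<open>x \<notin> (T \<inter> U)(T \<inter> V)\<close> survives at a prime that contains all \<open>r\<close> with \<open>rx \<in> (T \<inter> U)(T \<inter> V)\<close>. This
gives one implication (\<open>arithmetic_imp_distributive\<close>).

For the converse, fix \<open>P\<close>. Subintegrality provides a unique prime \<open>Q\<close> of \<open>S\<close> over \<open>P\<close>; every intermediate
ring becomes local at \<open>P\<close>, with maximal ideal cut out by \<open>Q\<close> and with the residue field of \<open>P\<close>
(\<open>subintegral_residually_trivial_prime\<close>). Suppose that \<open>T\<close> and \<open>U\<close> are incomparable saturated rings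
and put \<open>W = T \<inter> U\<close>. By FCP there are minimal saturated covers of \<open>W\<close> inside \<open>T\<close> and inside \<open>U\<close>.
Nakayama's lemma (\<open>minimal_cover_mult_prime\<close>) shows that these covers are ramified: they contain \<open>x\<close>
and \<open>y\<close> in \<open>Q\<close>, outside \<open>W\<close>, such that \<open>x\<^sup>2\<close>, \<open>y\<^sup>2\<close>, \<open>(Q \<inter> W)x\<close> and \<open>(Q \<inter> W)y\<close> lie in \<open>Q \<inter> W\<close>. Over
the residue field, \<open>1\<close>, \<open>x\<close>, \<open>y\<close> and, unless it vanishes, \<open>xy\<close> are linearly independent. Hence
\<open>W[x, xy]\<close>, \<open>W[y, xy]\<close> and \<open>W[x + y, xy]\<close> are three different rings over \<open>W + Wxy\<close> that sit in the
lattice like three lines through the origin of a plane, which contradicts distributivity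
(\<open>cover_pair_contradicts_distributivity\<close>).
\<close>

section \<open>Saturated rings and integral elements\<close>

definition saturation :: "('a, 'm) ring_scheme \<Rightarrow> 'a set \<Rightarrow> 'a set \<Rightarrow> 'a set" where
  "saturation S D T = {x \<in> carrier S. \<exists>s\<in>D. s \<otimes>\<^bsub>S\<^esub> x \<in> T}"

text \<open>For \<open>D = R - P\<close>, the saturated rings between \<open>R\<close> and \<open>S\<close> are the contractions to \<open>S\<close> of the rings
between \<open>R\<^sub>P\<close> and \<open>S\<^sub>P\<close>. Working with them replaces computations with fractions by computations
in \<open>S\<close> in which equations hold after multiplication by some element of \<open>D\<close>.\<close>

definition saturated :: "('a, 'm) ring_scheme \<Rightarrow> 'a set \<Rightarrow> 'a set \<Rightarrow> bool" where
  "saturated S D T \<longleftrightarrow> (\<forall>x\<in>carrier S. \<forall>s\<in>D. s \<otimes>\<^bsub>S\<^esub> x \<in> T \<longrightarrow> x \<in> T)"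

lemma saturatedD:
  "\<lbrakk>saturated S D T; s \<otimes>\<^bsub>S\<^esub> x \<in> T; s \<in> D; x \<in> carrier S\<rbrakk> \<Longrightarrow> x \<in> T"
  unfolding saturated_def by blast

lemma saturated_Int:
  "saturated S D T \<Longrightarrow> saturated S D U \<Longrightarrow> saturated S D (T \<inter> U)"
  unfolding saturated_def by blast

lemma saturation_least:
  "T \<subseteq> U \<Longrightarrow> saturated S D U \<Longrightarrow> saturation S D T \<subseteq> U"
  unfolding saturated_def saturation_def by blast

lemma intermediate_ringsD:
  assumes "T \<in> intermediate_rings S R"
  shows "subring T S" "R \<subseteq> T" "T \<subseteq> carrier S"
  using assms subringE(1) unfolding intermediate_rings_def by auto

context cring
begin

lemma subring_minus_closed:
  "\<lbrakk>subring T R; x \<in> T; y \<in> T\<rbrakk> \<Longrightarrow> x \<ominus> y \<in> T"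
  unfolding minus_eq by (intro subringE(7,5))

lemma subset_saturation:
  assumes "submonoid D R" "T \<subseteq> carrier R"
  shows "T \<subseteq> saturation R D T"
  using assms submonoid.one_closed[OF assms(1)] unfolding saturation_def by force

lemma saturated_saturation:
  assumes "submonoid D R"
  shows "saturated R D (saturation R D T)"
proof -
  interpret D: submonoid D R by fact
  show ?thesis
    unfolding saturated_def saturation_def
    by (auto simp: m_assoc[symmetric] intro: D.m_closed)
qed

lemma subring_saturation:
  assumes D: "submonoid D R" and T: "subring T R" and "D \<subseteq> T"
  shows "subring (saturation R D T) R"
proof -
  interpret D: submonoid D R by fact
  note Tc = subringE[OF T]
  show ?thesis
  proof (rule subringI)
    show "saturation R D T \<subseteq> carrier R" unfolding saturation_def by auto
    show "\<one> \<in> saturation R D T"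
      using subset_saturation[OF D Tc(1)] Tc(3) by blast
    show "\<ominus> x \<in> saturation R D T" if "x \<in> saturation R D T" for x
      using that Tc(5) unfolding saturation_def by (force simp: r_minus)
    fix x y assume "x \<in> saturation R D T" "y \<in> saturation R D T"
    then obtain s t where st: "s \<in> D" "t \<in> D" "s \<otimes> x \<in> T" "t \<otimes> y \<in> T"
      and c: "x \<in> carrier R" "y \<in> carrier R" "s \<in> carrier R" "t \<in> carrier R"
      unfolding saturation_def by auto
    have "(s \<otimes> t) \<otimes> (x \<otimes> y) = (s \<otimes> x) \<otimes> (t \<otimes> y)" using c by algebra
    moreover have "(s \<otimes> t) \<otimes> (x \<oplus> y) = t \<otimes> (s \<otimes> x) \<oplus> s \<otimes> (t \<otimes> y)" using c by algebra
    moreover have "(s \<otimes> x) \<otimes> (t \<otimes> y) \<in> T" "t \<otimes> (s \<otimes> x) \<oplus> s \<otimes> (t \<otimes> y) \<in> T"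
      using st \<open>D \<subseteq> T\<close> by (auto intro!: Tc(6,7))
    ultimately show "x \<otimes> y \<in> saturation R D T" "x \<oplus> y \<in> saturation R D T"
      unfolding saturation_def using st(1,2) c by (auto intro!: bexI[of _ "s \<otimes> t"])
  qed
qed

text \<open>The ideal \<open>aU\<close> of \<open>U\<close> can be added to any subring of \<open>U\<close>. Principal ideals suffice for the
Nakayama argument below, so no sums of products have to be handled.\<close>

lemma subring_plus_multiples:
  assumes W: "subring W R" and U: "subring U R" and "W \<subseteq> U" and a: "a \<in> U"
  shows "subring {w \<oplus> a \<otimes> u | w u. w \<in> W \<and> u \<in> U} R" (is "subring ?V R")
proof (rule subringI)
  note Wc = subringE[OF W] and Uc = subringE[OF U]
  have ac: "a \<in> carrier R" using a Uc(1) by blast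
  show "?V \<subseteq> carrier R" using Wc(1) Uc(1) ac by auto
  have "\<one> = \<one> \<oplus> a \<otimes> \<zero>" using ac by simp
  then show "\<one> \<in> ?V" using Wc(3) Uc(2) by blast
  show "\<ominus> h \<in> ?V" if h: "h \<in> ?V" for h
  proof -
    obtain w u where 1: "h = w \<oplus> a \<otimes> u" "w \<in> W" "u \<in> U" using h by blast
    moreover have "w \<in> carrier R" "u \<in> carrier R" using 1 Wc(1) Uc(1) by auto
    then have "\<ominus> (w \<oplus> a \<otimes> u) = \<ominus> w \<oplus> a \<otimes> (\<ominus> u)" using ac by algebra
    ultimately show ?thesis using Wc(5) Uc(5) by blast
  qed
  fix h k assume "h \<in> ?V" "k \<in> ?V"
  then obtain w u w' u' where 1: "h = w \<oplus> a \<otimes> u" "w \<in> W" "u \<in> U"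
      "k = w' \<oplus> a \<otimes> u'" "w' \<in> W" "u' \<in> U" by blast
  have c: "w \<in> carrier R" "u \<in> carrier R" "w' \<in> carrier R" "u' \<in> carrier R"
    using 1 Wc(1) Uc(1) by auto
  have "h \<oplus> k = (w \<oplus> w') \<oplus> a \<otimes> (u \<oplus> u')"
    "h \<otimes> k = (w \<otimes> w') \<oplus> a \<otimes> (w \<otimes> u' \<oplus> (u \<otimes> w' \<oplus> u \<otimes> (a \<otimes> u')))"
    unfolding 1 using c ac by algebra+
  moreover have "w \<otimes> u' \<oplus> (u \<otimes> w' \<oplus> u \<otimes> (a \<otimes> u')) \<in> U"
    using 1 a \<open>W \<subseteq> U\<close> Uc(6,7) by (meson subsetD)
  ultimately show "h \<otimes> k \<in> ?V" "h \<oplus> k \<in> ?V"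
    using 1 Wc(6,7) Uc(7) by blast+
qed

text \<open>The \<open>W\<close>-module spanned by the \<open>n\<close> powers \<open>1, x, \<dots>, x\<^bsup>n-1\<^esup>\<close>. An element \<open>x\<close> is integral over \<open>W\<close>
of degree \<open>n\<close> exactly when \<open>x\<^bsup>n\<^esup>\<close> lies in it, and the recursion peels off the highest power,
which is what the inductions on the number of generators need.\<close>

primrec power_span :: "'a set \<Rightarrow> 'a \<Rightarrow> nat \<Rightarrow> 'a set" where
  "power_span W x 0 = {\<zero>}"
| "power_span W x (Suc n) = {w \<otimes> x [^] n \<oplus> y | w y. w \<in> W \<and> y \<in> power_span W x n}"

lemma power_span_subset_subring:
  assumes "subring T R" "W \<subseteq> T" "x \<in> T"
  shows "power_span W x n \<subseteq> T"
proof -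
  note Tc = subringE[OF assms(1)]
  have "x [^] k \<in> T" for k :: nat by (induction k) (auto simp: Tc assms)
  then have "w \<otimes> x [^] k \<oplus> y \<in> T" if "w \<in> W" "y \<in> T" for w y and k :: nat
    using that assms(2) by (intro Tc(6,7)) auto
  then show ?thesis using Tc(2) by (induction n) auto
qed

context
  fixes W x
  assumes W: "subring W R" and x: "x \<in> carrier R"
begin

lemma power_span_carrier: "power_span W x n \<subseteq> carrier R"
  using power_span_subset_subring[OF carrier_is_subring _ x] subringE(1)[OF W] by blast

lemma power_span_zero: "\<zero> \<in> power_span W x n"
proof (induction n)
  case (Suc n)
  have "\<zero> = \<zero> \<otimes> x [^] n \<oplus> \<zero>" using x by simp
  then show ?case using Suc subringE(2)[OF W] unfolding power_span.simps by blast
qed simp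

lemma power_span_Suc_subset: "power_span W x n \<subseteq> power_span W x (Suc n)"
proof
  fix y assume y: "y \<in> power_span W x n"
  then have "y = \<zero> \<otimes> x [^] n \<oplus> y" using x power_span_carrier[of n] by auto
  then show "y \<in> power_span W x (Suc n)"
    using y subringE(2)[OF W] unfolding power_span.simps by blast
qed

lemma power_span_power: "w \<in> W \<Longrightarrow> w \<otimes> x [^] n \<in> power_span W x (Suc n)"
proof -
  assume w: "w \<in> W"
  then have "w \<otimes> x [^] n = w \<otimes> x [^] n \<oplus> \<zero>" using subringE(1)[OF W] x by auto
  then show ?thesis using w power_span_zero[of n] unfolding power_span.simps by blast
qed

lemma power_span_add:
  "y \<in> power_span W x n \<Longrightarrow> z \<in> power_span W x n \<Longrightarrow> y \<oplus> z \<in> power_span W x n"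
proof (induction n arbitrary: y z)
  case (Suc n)
  then obtain w y' v z' where 1: "y = w \<otimes> x [^] n \<oplus> y'" "z = v \<otimes> x [^] n \<oplus> z'"
      "w \<in> W" "v \<in> W" "y' \<in> power_span W x n" "z' \<in> power_span W x n" by auto
  moreover have "w \<in> carrier R" "v \<in> carrier R" "y' \<in> carrier R" "z' \<in> carrier R"
    using 1 power_span_carrier[of n] subringE(1)[OF W] by auto
  then have "y \<oplus> z = (w \<oplus> v) \<otimes> x [^] n \<oplus> (y' \<oplus> z')"
    unfolding 1 using x nat_pow_closed[OF x, of n] by algebra
  ultimately show ?case using Suc.IH[of y' z'] subringE(7)[OF W] by auto
qed simp

lemma power_span_scale:
  "w \<in> W \<Longrightarrow> z \<in> power_span W x n \<Longrightarrow> w \<otimes> z \<in> power_span W x n"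
proof (induction n arbitrary: z)
  case 0 then show ?case using subringE(1)[OF W] by auto
next
  case (Suc n)
  then obtain v z' where 1: "z = v \<otimes> x [^] n \<oplus> z'" "v \<in> W" "z' \<in> power_span W x n" by auto
  moreover have "w \<in> carrier R" "v \<in> carrier R" "z' \<in> carrier R"
    using 1 Suc power_span_carrier[of n] subringE(1)[OF W] by auto
  then have "w \<otimes> z = (w \<otimes> v) \<otimes> x [^] n \<oplus> (w \<otimes> z')"
    unfolding 1 using x nat_pow_closed[OF x, of n] by algebra
  ultimately show ?case using Suc.IH[of z'] Suc.prems subringE(6)[OF W] by auto
qed

lemma power_span_shift:
  "z \<in> power_span W x n \<Longrightarrow> x \<otimes> z \<in> power_span W x (Suc n)"
proof (induction n arbitrary: z)
  case 0 
  then show ?case using power_span_zero[of 1] x by simp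
next
  case (Suc n)
  then obtain v z' where 1: "z = v \<otimes> x [^] n \<oplus> z'" "v \<in> W" "z' \<in> power_span W x n" by auto
  have c: "v \<in> carrier R" "z' \<in> carrier R"
    using 1 power_span_carrier[of n] subringE(1)[OF W] by auto
  have "x \<otimes> z = v \<otimes> (x [^] n \<otimes> x) \<oplus> (x \<otimes> z')"
    unfolding 1 using x c nat_pow_closed[OF x, of n] by algebra
  then have "x \<otimes> z = v \<otimes> x [^] (Suc n) \<oplus> (x \<otimes> z')" by simp
  then show ?case using Suc.IH[OF 1(3)] 1(2) unfolding power_span.simps(2)[of _ _ "Suc n"] by blast
qed

lemma subset_power_span:
  assumes "n > 0"
  shows "W \<subseteq> power_span W x n"
proof
  fix w assume w: "w \<in> W"
  have "w \<in> power_span W x (Suc k)" for k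
  proof (induction k)
    case 0
    have "w \<otimes> x [^] (0::nat) = w" using w subringE(1)[OF W] by auto
    then show ?case using power_span_power[OF w, of 0] by metis
  next
    case (Suc k) then show ?case using power_span_Suc_subset by blast
  qed
  then show "w \<in> power_span W x n" using assms gr0_conv_Suc by metis
qed

text \<open>Once \<open>x\<close> satisfies a monic equation of degree \<open>n\<close>, multiplication by \<open>x\<close> maps the span of the
powers below \<open>n\<close> into itself, so that this span is all of \<open>W[x]\<close>.\<close>

lemma subring_power_span:
  assumes mon: "x [^] n \<in> power_span W x n" and n: "n > 0"
  shows "subring (power_span W x n) R" "x \<in> power_span W x n"
proof -
  have red: "power_span W x (Suc n) \<subseteq> power_span W x n"
    using power_span_add[OF power_span_scale[OF _ mon]] by auto
  have pow: "x [^] k \<otimes> z \<in> power_span W x n" if "z \<in> power_span W x n" for k :: nat and z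
  proof (induction k)
    case 0 then show ?case using that power_span_carrier[of n] by auto
  next
    case (Suc k)
    have "x [^] (Suc k) \<otimes> z = x \<otimes> (x [^] k \<otimes> z)"
      using that power_span_carrier[of n] x by (auto simp: m_ac)
    then show ?case using power_span_shift[OF Suc] red by auto
  qed
  have prod: "y \<otimes> z \<in> power_span W x n"
    if z: "z \<in> power_span W x n" and "y \<in> power_span W x k" for y z k
    using that(2)
  proof (induction k arbitrary: y)
    case 0 then show ?case using z power_span_carrier[of n] power_span_zero[of n] by auto
  next
    case (Suc k)
    then obtain w y' where 1: "y = w \<otimes> x [^] k \<oplus> y'" "w \<in> W" "y' \<in> power_span W x k" by auto
    have "y \<otimes> z = w \<otimes> (x [^] k \<otimes> z) \<oplus> y' \<otimes> z"
      using 1 z power_span_carrier[of n] power_span_carrier[of k] subringE(1)[OF W] x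
      by (auto simp: l_distr m_assoc subset_eq)
    then show ?case using power_span_add power_span_scale pow[OF z] 1 Suc.IH by auto
  qed
  have sub: "W \<subseteq> power_span W x n" using subset_power_span[OF n] .
  have one: "\<one> \<in> power_span W x n" using sub subringE(3)[OF W] by blast
  have "x \<otimes> \<one> \<in> power_span W x n" using power_span_shift[OF one] red by blast
  then show "x \<in> power_span W x n" using x by simp
  show "subring (power_span W x n) R"
  proof (rule subringI)
    show "power_span W x n \<subseteq> carrier R" by (rule power_span_carrier)
    show "\<one> \<in> power_span W x n" by (rule one)
    show "\<ominus> h \<in> power_span W x n" if "h \<in> power_span W x n" for h
      using power_span_scale[of "\<ominus> \<one>" h n] that power_span_carrier[of n]
        subringE(3,5)[OF W] by (auto simp: l_minus)
  qed (auto intro: prod power_span_add)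
qed

lemma integral_imp_power_in_span:
  assumes "p \<noteq> []" "hd p = \<one>" "set p \<subseteq> W" "eval p x = \<zero>"
  obtains n where "n > 0" "x [^] n \<in> power_span W x n"
proof -
  have ev: "eval q x \<in> power_span W x (length q)" if "set q \<subseteq> W" for q
    using that by (induction q) auto
  obtain q where q: "p = \<one> # q" using assms(1,2) by (cases p) auto
  have qc: "eval q x \<in> carrier R" using ev[of q] assms(3) q power_span_carrier by auto
  have "x [^] length q \<oplus> eval q x = \<zero>" using assms(4) q x by simp
  then have "x [^] length q = \<ominus> eval q x"
    using qc x by (simp add: add.inv_equality minus_equality sum_zero_eq_neg)
  also have "\<dots> = \<ominus> \<one> \<otimes> eval q x" using qc by (simp add: l_minus)
  also have "\<dots> \<in> power_span W x (length q)"
    using assms(3) q ev[of q] power_span_scale subringE(3,5)[OF W] by auto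
  finally have "x [^] length q \<in> power_span W x (length q)" .
  \<comment> \<open>The equation is multiplied by \<open>x\<close> because \<open>p = [1]\<close> would give degree \<open>0\<close>.\<close>
  from power_span_shift[OF this] have "x [^] Suc (length q) \<in> power_span W x (Suc (length q))"
    using x by (simp add: m_comm)
  then show ?thesis using that by blast
qed

end

end

section \<open>Primes avoiding a multiplicative set and lying over\<close>

text \<open>An ideal maximal among those that miss a multiplicative set is prime. The last conclusion, that
every larger ideal meets \<open>D\<close>, is kept because the lying-over argument uses it directly.\<close>

lemma (in cring) exists_ideal_maximal_disjoint:
  assumes I: "ideal I R" and D: "submonoid D R" and disj: "I \<inter> D = {}"
  obtains Q where "primeideal Q R" "I \<subseteq> Q" "Q \<inter> D = {}"
    "\<And>a. a \<in> carrier R - Q \<Longrightarrow> \<exists>q\<in>Q. \<exists>c\<in>carrier R. q \<oplus> c \<otimes> a \<in> D"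
proof -
  interpret D: submonoid D R by fact
  let ?F = "{J. ideal J R \<and> I \<subseteq> J \<and> J \<inter> D = {}}"
  have "\<exists>Q\<in>?F. \<forall>J\<in>?F. Q \<subseteq> J \<longrightarrow> J = Q"
  proof (rule subset_Zorn_nonempty)
    show "?F \<noteq> {}" using I disj by blast
    fix C assume C: "C \<noteq> {}" "subset.chain ?F C"
    then have "subset.chain {J. ideal J R} C" by (auto simp: subset_chain_def)
    then have "ideal (\<Union>C) R" using chain_Union_is_ideal[of C] C(1) by simp
    then show "\<Union>C \<in> ?F" using C by (auto simp: subset_chain_def)
  qed
  then obtain Q where QF: "Q \<in> ?F" "\<forall>J\<in>?F. Q \<subseteq> J \<longrightarrow> J = Q" by (rule bexE)
  then have Q: "ideal Q R" "I \<subseteq> Q" "Q \<inter> D = {}" by simp_all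
  have max: "J = Q" if "ideal J R" "Q \<subseteq> J" "J \<inter> D = {}" for J
  proof -
    have "J \<in> ?F" using that subset_trans[OF Q(2) that(2)] by simp
    then show ?thesis using QF(2) that(2) by simp
  qed
  interpret Q: ideal Q R by fact
  have zQ: "\<zero> \<in> Q" by (rule additive_subgroup.zero_closed[OF Q.is_additive_subgroup])
  have hit: "\<exists>q\<in>Q. \<exists>c\<in>carrier R. q \<oplus> c \<otimes> a \<in> D" if a: "a \<in> carrier R - Q" for a
  proof -
    let ?J = "set_add R Q (PIdl a)"
    have ac: "a \<in> carrier R" "a \<notin> Q" using a by auto
    have J: "ideal ?J R" using add_ideals[OF Q(1) cgenideal_ideal[OF ac(1)]] .
    have mem: "z \<in> ?J \<longleftrightarrow> (\<exists>q\<in>Q. \<exists>c\<in>carrier R. z = q \<oplus> c \<otimes> a)" for z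
      unfolding set_add_defs cgenideal_def by auto
    have "Q \<subseteq> ?J"
    proof
      fix q assume q: "q \<in> Q"
      then have "q = q \<oplus> \<zero> \<otimes> a" using ac(1) Q.Icarr by simp
      then show "q \<in> ?J" unfolding mem using q zero_closed by blast
    qed
    moreover have "a = \<zero> \<oplus> \<one> \<otimes> a" using ac(1) by simp
    then have "a \<in> ?J" unfolding mem using zQ one_closed by blast
    ultimately have "?J \<inter> D \<noteq> {}" using max[OF J] ac(2) by blast
    then obtain d where "d \<in> D" "d \<in> ?J" by blast
    then show ?thesis unfolding mem by blast
  qed
  have "primeideal Q R"
  proof (rule primeidealI[OF Q(1) is_cring])
    show "carrier R \<noteq> Q" using Q(3) D.one_closed by blast
    fix a b assume ab: "a \<in> carrier R" "b \<in> carrier R" "a \<otimes> b \<in> Q"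
    show "a \<in> Q \<or> b \<in> Q"
    proof (rule ccontr)
      assume "\<not> (a \<in> Q \<or> b \<in> Q)"
      then obtain q c q' c' where h: "q \<in> Q" "c \<in> carrier R" "q \<oplus> c \<otimes> a \<in> D"
          "q' \<in> Q" "c' \<in> carrier R" "q' \<oplus> c' \<otimes> b \<in> D"
        using hit[of a] hit[of b] ab by blast
      have qc: "q \<in> carrier R" "q' \<in> carrier R" using h Q.Icarr by auto
      have "(q \<oplus> c \<otimes> a) \<otimes> (q' \<oplus> c' \<otimes> b)
          = q \<otimes> (q' \<oplus> c' \<otimes> b) \<oplus> (c \<otimes> a) \<otimes> q' \<oplus> (c \<otimes> c') \<otimes> (a \<otimes> b)"
        using h(2,5) qc ab by algebra
      also have "\<dots> \<in> Q"
        using h ab qc by (intro Q.a_closed Q.I_l_closed[OF ab(3)] Q.I_l_closed[OF h(4)] Q.I_r_closed[OF h(1)]) auto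
      finally show False using D.m_closed[OF h(3,6)] Q(3) by blast
    qed
  qed
  then show ?thesis using that Q hit by blast
qed

lemma (in cring) prime_of_subringD:
  assumes A: "subring A R" and P: "primeideal P (R\<lparr>carrier := A\<rparr>)"
  shows "P \<subseteq> A" "\<zero> \<in> P" "\<one> \<notin> P"
    and "\<And>x y. \<lbrakk>x \<in> P; y \<in> P\<rbrakk> \<Longrightarrow> x \<oplus> y \<in> P"
    and "\<And>x y. \<lbrakk>x \<in> A; y \<in> P\<rbrakk> \<Longrightarrow> x \<otimes> y \<in> P"
    and "\<And>x y. \<lbrakk>x \<in> A; y \<in> A; x \<otimes> y \<in> P\<rbrakk> \<Longrightarrow> x \<in> P \<or> y \<in> P"
    and "submonoid (A - P) R"
proof -
  interpret P: primeideal P "R\<lparr>carrier := A\<rparr>" by fact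
  show "P \<subseteq> A" using P.a_subset by simp
  show "\<zero> \<in> P" using additive_subgroup.zero_closed[OF P.is_additive_subgroup] by simp
  show 1: "\<one> \<notin> P" using P.one_imp_carrier P.I_notcarr by auto
  show "x \<oplus> y \<in> P" if "x \<in> P" "y \<in> P" for x y 
    using additive_subgroup.a_closed[OF P.is_additive_subgroup] that by simp
  show "x \<otimes> y \<in> P" if "x \<in> A" "y \<in> P" for x y using P.I_l_closed that by simp
  show p: "x \<in> P \<or> y \<in> P" if "x \<in> A" "y \<in> A" "x \<otimes> y \<in> P" for x y using P.I_prime that by simp
  show "submonoid (A - P) R"
    using 1 p subringE(1,3,6)[OF A] by unfold_locales blast+
qed

text \<open>Lying over, for a prime that contains a prescribed element \<open>s\<close> none of whose multiples lies in
\<open>A - P\<close>. An ideal \<open>Q\<close> containing \<open>s\<close> and maximal among those missing \<open>A - P\<close> meets \<open>A\<close> inside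
\<open>P\<close>. If some \<open>a \<in> P\<close> were outside \<open>Q\<close>, then \<open>d \<equiv> ca\<close> modulo \<open>Q\<close> for some \<open>d \<in> A - P\<close>; multiplying an
integral equation of degree \<open>n\<close> for \<open>c\<close> by \<open>a\<^bsup>n\<^esup>\<close> gives \<open>d\<^bsup>n\<^esup> \<in> P + Q\<close>, hence \<open>d \<in> P\<close>.\<close>

lemma (in cring) exists_prime_over_containing:
  assumes A: "subring A R" and P: "primeideal P (R\<lparr>carrier := A\<rparr>)"
    and int: "\<And>c. c \<in> carrier R \<Longrightarrow> \<exists>n. c [^] n \<in> power_span A c n"
    and s: "s \<in> carrier R" and avoid: "\<And>y. y \<in> carrier R \<Longrightarrow> y \<otimes> s \<notin> A - P"
  obtains Q where "primeideal Q R" "s \<in> Q" "Q \<inter> A = P"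
proof -
  note Ac = subringE[OF A] and Pc = prime_of_subringD[OF A P]
  have "PIdl s \<inter> (A - P) = {}" using avoid unfolding cgenideal_def by blast
  then obtain Q where Q: "primeideal Q R" "PIdl s \<subseteq> Q" "Q \<inter> (A - P) = {}"
    and hit: "\<And>a. a \<in> carrier R - Q \<Longrightarrow> \<exists>q\<in>Q. \<exists>c\<in>carrier R. q \<oplus> c \<otimes> a \<in> A - P"
    using exists_ideal_maximal_disjoint[OF cgenideal_ideal[OF s] Pc(7)] by metis
  interpret Q: primeideal Q R by fact
  have zQ: "\<zero> \<in> Q" by (rule additive_subgroup.zero_closed[OF Q.is_additive_subgroup])
  have "P \<subseteq> Q"
  proof
    fix a assume a: "a \<in> P"
    show "a \<in> Q"
    proof (rule ccontr)
      assume "a \<notin> Q"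
      have ac: "a \<in> carrier R" "a \<in> A" using a Pc(1) Ac(1) by auto
      obtain q c where qc: "q \<in> Q" "c \<in> carrier R" "q \<oplus> c \<otimes> a \<in> A - P"
        using hit \<open>a \<notin> Q\<close> ac by blast
      define d where "d = q \<oplus> c \<otimes> a"
      have d: "d \<in> A" "d \<notin> P" "d \<in> carrier R" using qc(3) Ac(1) unfolding d_def by auto
      have qR: "q \<in> carrier R" using qc(1) by (rule Q.Icarr)
      have dpow: "d [^] k \<in> A" "d [^] k \<notin> P" for k :: nat
      proof (induction k)
        case (Suc k)
        { case 1 show ?case using Suc d(1) Ac(6) by simp }
        { case 2 show ?case using Suc d(1,2) Pc(6)[of "d [^] k" d] by auto }
      qed (use Ac(3) Pc(3) in auto)
      \<comment> \<open>Modulo \<open>Q\<close>, the element \<open>(ac)\<^sup>k\<close> equals \<open>d\<^sup>k\<close>.\<close>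
      have cpow: "\<exists>q'\<in>Q. a [^] k \<otimes> c [^] k = d [^] k \<oplus> q'" for k :: nat
      proof (induction k)
        case 0 show ?case using zQ by (intro bexI[of _ \<zero>]) auto
      next
        case (Suc k)
        then obtain q' where q': "q' \<in> Q" "a [^] k \<otimes> c [^] k = d [^] k \<oplus> q'" by blast
        have q'R: "q' \<in> carrier R" using q'(1) by (rule Q.Icarr)
        have "a [^] Suc k \<otimes> c [^] Suc k = (a [^] k \<otimes> c [^] k) \<otimes> (c \<otimes> a)"
          using ac qc(2) by (simp add: m_ac)
        also have "c \<otimes> a = d \<oplus> \<ominus> q" unfolding d_def using qR qc(2) ac by algebra
        also have "(a [^] k \<otimes> c [^] k) \<otimes> (d \<oplus> \<ominus> q) = d [^] k \<otimes> d \<oplus> ((\<ominus> (d [^] k \<oplus> q')) \<otimes> q \<oplus> d \<otimes> q')"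
          unfolding q'(2) using d(3) nat_pow_closed[OF d(3), of k] qR q'R by algebra
        finally have "a [^] Suc k \<otimes> c [^] Suc k = d [^] Suc k \<oplus> ((\<ominus> (d [^] k \<oplus> q')) \<otimes> q \<oplus> d \<otimes> q')"
          by simp
        moreover have "(\<ominus> (d [^] k \<oplus> q')) \<otimes> q \<oplus> d \<otimes> q' \<in> Q"
          using qc(1) q'(1) q'R d(3) by (intro Q.a_closed Q.I_l_closed) auto
        ultimately show ?case by blast
      qed
      \<comment> \<open>Multiplying by \<open>a\<^sup>k\<close> turns each \<open>c\<^sup>i\<close> with \<open>i < k\<close> into a multiple of \<open>a d\<^sup>i\<close> modulo \<open>Q\<close>,
        which is where a factor from \<open>P\<close> remains.\<close>
      have span: "\<exists>p\<in>P. \<exists>q'\<in>Q. a [^] k \<otimes> z = p \<oplus> q'" if "z \<in> power_span A c k" for z k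
        using that
      proof (induction k arbitrary: z)
        case 0
        then show ?case using Pc(2) zQ by (intro bexI[of _ \<zero>]) auto
      next
        case (Suc k)
        then obtain w z' where z: "z = w \<otimes> c [^] k \<oplus> z'" "w \<in> A" "z' \<in> power_span A c k" by auto
        obtain p q1 where 1: "p \<in> P" "q1 \<in> Q" "a [^] k \<otimes> z' = p \<oplus> q1" using Suc.IH[OF z(3)] by blast
        obtain q2 where 2: "q2 \<in> Q" "a [^] k \<otimes> c [^] k = d [^] k \<oplus> q2" using cpow by blast
        have C: "w \<in> carrier R" "z' \<in> carrier R" "p \<in> carrier R" "q1 \<in> carrier R" "q2 \<in> carrier R"
          using z 1 2 Ac(1) Pc(1) Q.Icarr power_span_carrier[OF A qc(2)] by auto
        have pw: "a [^] k \<in> carrier R" "c [^] k \<in> carrier R" "d [^] k \<in> carrier R"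
          using ac qc(2) d(3) by auto
        have "a [^] Suc k \<otimes> z = (a \<otimes> w) \<otimes> (a [^] k \<otimes> c [^] k) \<oplus> a \<otimes> (a [^] k \<otimes> z')"
          unfolding z(1) using ac(1) qc(2) C(1,2) pw by (simp add: r_distr m_ac)
        also have "\<dots> = ((w \<otimes> d [^] k) \<otimes> a \<oplus> a \<otimes> p) \<oplus> ((a \<otimes> w) \<otimes> q2 \<oplus> a \<otimes> q1)"
          unfolding 1(3) 2(2) using ac(1) C pw by algebra
        finally have "a [^] Suc k \<otimes> z = ((w \<otimes> d [^] k) \<otimes> a \<oplus> a \<otimes> p) \<oplus> ((a \<otimes> w) \<otimes> q2 \<oplus> a \<otimes> q1)" .
        moreover have "(w \<otimes> d [^] k) \<otimes> a \<oplus> a \<otimes> p \<in> P"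
          using Pc(5)[OF Ac(6)[OF z(2) dpow(1)] a] Pc(5)[OF ac(2) 1(1)] Pc(4) by blast
        moreover have "(a \<otimes> w) \<otimes> q2 \<oplus> a \<otimes> q1 \<in> Q"
          using 1 2 ac(1) C by (intro Q.a_closed Q.I_l_closed) auto
        ultimately show ?case by blast
      qed
      obtain n where "c [^] n \<in> power_span A c n" using int[OF qc(2)] by blast
      then obtain p q1 where p: "p \<in> P" "q1 \<in> Q" "a [^] n \<otimes> c [^] n = p \<oplus> q1" using span by blast
      obtain q2 where q2: "q2 \<in> Q" "a [^] n \<otimes> c [^] n = d [^] n \<oplus> q2" using cpow by blast
      have C: "p \<in> carrier R" "q1 \<in> carrier R" "q2 \<in> carrier R" "d [^] n \<in> carrier R"
        using p q2 Pc(1) Ac(1) Q.Icarr d(3) by auto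
      have "d [^] n \<oplus> \<ominus> p = (d [^] n \<oplus> q2) \<oplus> \<ominus> (p \<oplus> q2)" using C by algebra
      also have "d [^] n \<oplus> q2 = p \<oplus> q1" using p(3) q2(2) by simp
      also have "(p \<oplus> q1) \<oplus> \<ominus> (p \<oplus> q2) = q1 \<oplus> \<ominus> q2" using C by algebra
      finally have "d [^] n \<oplus> \<ominus> p \<in> Q" using p(2) q2(1) by simp
      moreover have "d [^] n \<oplus> \<ominus> p \<in> A" using dpow(1) p(1) Pc(1) Ac(5,7) by blast
      ultimately have "d [^] n \<oplus> \<ominus> p \<in> P" using Q(3) by blast
      then have "(d [^] n \<oplus> \<ominus> p) \<oplus> p \<in> P" using p(1) Pc(4) by blast
      moreover have "(d [^] n \<oplus> \<ominus> p) \<oplus> p = d [^] n" using C by algebra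
      ultimately show False using dpow(2) by simp
    qed
  qed
  then have "Q \<inter> A = P" using Q(3) Pc(1) by blast
  moreover have "s \<in> Q" using cgenideal_self[OF s] Q(2) by blast
  ultimately show ?thesis using that Q(1) by blast
qed

section \<open>Localizations as rings\<close>

context cring
begin

context
  fixes M
  assumes M: "submonoid M R"
begin

lemma fraction_eq_iff:
  assumes "a \<in> carrier R" "s \<in> M" "b \<in> carrier R" "t \<in> M"
  shows "fraction R M a s = fraction R M b t \<longleftrightarrow> (\<exists>u\<in>M. u \<otimes> (a \<otimes> t) = u \<otimes> (b \<otimes> s))"
proof -
  have "fraction R M a s = fraction R M b t \<longleftrightarrow> ((a, s), (b, t)) \<in> fraction_rel R M"
    unfolding fraction_def
    using eq_equiv_class_iff[OF equiv_fraction_rel[OF is_cring M]] assms by simp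
  then show ?thesis unfolding fraction_rel_def using assms by simp
qed

lemma fraction_eq_crossI:
  assumes "a \<in> carrier R" "s \<in> M" "b \<in> carrier R" "t \<in> M" "a \<otimes> t = b \<otimes> s"
  shows "fraction R M a s = fraction R M b t"
  using assms submonoid.one_closed[OF M] by (auto simp: fraction_eq_iff)

lemma localization_carrier:
  "carrier (localization R M) = {fraction R M a s | a s. a \<in> carrier R \<and> s \<in> M}"
  unfolding localization_def fraction_def quotient_def by auto

lemma localization_one_zero:
  "\<one>\<^bsub>localization R M\<^esub> = fraction R M \<one> \<one>" "\<zero>\<^bsub>localization R M\<^esub> = fraction R M \<zero> \<one>"
  unfolding localization_def by auto

lemma localization_cring: "cring (localization R M)"
proof -
  interpret M: submonoid M R by fact
  let ?L = "localization R M"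
  note Mc = subsetD[OF M.subset]
  note fm = fraction_mult[OF is_cring M] and fa = fraction_add[OF is_cring M]
  have E: "\<exists>a s. F = fraction R M a s \<and> a \<in> carrier R \<and> s \<in> M" if "F \<in> carrier ?L" for F
    using that unfolding localization_carrier by blast
  have I: "fraction R M a s \<in> carrier ?L" if "a \<in> carrier R" "s \<in> M" for a s
    using that unfolding localization_carrier by blast
  show ?thesis
  proof (rule cringI)
    show "abelian_group ?L"
    proof (rule abelian_groupI)
      show "\<zero>\<^bsub>?L\<^esub> \<in> carrier ?L" unfolding localization_one_zero by (intro I) auto
      fix F assume "F \<in> carrier ?L"
      then obtain a s where F: "F = fraction R M a s" "a \<in> carrier R" "s \<in> M" using E by blast
      have sc: "s \<in> carrier R" using F Mc by auto
      show "\<zero>\<^bsub>?L\<^esub> \<oplus>\<^bsub>?L\<^esub> F = F"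
        unfolding localization_one_zero F(1) using F(2,3) sc by (simp add: fa)
      have "fraction R M (\<ominus> a) s \<oplus>\<^bsub>?L\<^esub> F = \<zero>\<^bsub>?L\<^esub>"
        unfolding localization_one_zero F(1) using F(2,3) sc
        by (simp add: fa) (rule fraction_eq_crossI, auto simp: l_minus l_neg)
      then show "\<exists>G\<in>carrier ?L. G \<oplus>\<^bsub>?L\<^esub> F = \<zero>\<^bsub>?L\<^esub>"
        using I[OF a_inv_closed[OF F(2)] F(3)] by (rule bexI)
      fix G assume "G \<in> carrier ?L"
      then obtain b t where G: "G = fraction R M b t" "b \<in> carrier R" "t \<in> M" using E by blast
      have tc: "t \<in> carrier R" using G Mc by auto
      show "F \<oplus>\<^bsub>?L\<^esub> G \<in> carrier ?L"
        unfolding F(1) G(1) using F(2,3) G(2,3) sc tc by (auto simp: fa intro!: I)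
      have "a \<otimes> t \<oplus> b \<otimes> s = b \<otimes> s \<oplus> a \<otimes> t" "s \<otimes> t = t \<otimes> s"
        using F(2) G(2) sc tc by algebra+
      then show "F \<oplus>\<^bsub>?L\<^esub> G = G \<oplus>\<^bsub>?L\<^esub> F"
        unfolding F(1) G(1) using F(2,3) G(2,3) by (simp add: fa)
      fix H assume "H \<in> carrier ?L"
      then obtain c r where H: "H = fraction R M c r" "c \<in> carrier R" "r \<in> M" using E by blast
      have rc: "r \<in> carrier R" using H Mc by auto
      have "(a \<otimes> t \<oplus> b \<otimes> s) \<otimes> r \<oplus> c \<otimes> (s \<otimes> t) = a \<otimes> (t \<otimes> r) \<oplus> (b \<otimes> r \<oplus> c \<otimes> t) \<otimes> s"
        using F(2) G(2) H(2) sc tc rc by algebra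
      then show "F \<oplus>\<^bsub>?L\<^esub> G \<oplus>\<^bsub>?L\<^esub> H = F \<oplus>\<^bsub>?L\<^esub> (G \<oplus>\<^bsub>?L\<^esub> H)"
        unfolding F(1) G(1) H(1) using F(2,3) G(2,3) H(2,3) sc tc rc by (simp add: fa m_assoc)
    qed
    show "comm_monoid ?L"
    proof (rule comm_monoidI)
      show "\<one>\<^bsub>?L\<^esub> \<in> carrier ?L" unfolding localization_one_zero by (intro I) auto
      fix F assume "F \<in> carrier ?L"
      then obtain a s where F: "F = fraction R M a s" "a \<in> carrier R" "s \<in> M" using E by blast
      have sc: "s \<in> carrier R" using F Mc by auto
      show "\<one>\<^bsub>?L\<^esub> \<otimes>\<^bsub>?L\<^esub> F = F"
        unfolding localization_one_zero F(1) using F(2,3) sc by (simp add: fm)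
      fix G assume "G \<in> carrier ?L"
      then obtain b t where G: "G = fraction R M b t" "b \<in> carrier R" "t \<in> M" using E by blast
      have tc: "t \<in> carrier R" using G Mc by auto
      show "F \<otimes>\<^bsub>?L\<^esub> G \<in> carrier ?L"
        unfolding F(1) G(1) using F(2,3) G(2,3) sc tc by (auto simp: fm intro!: I)
      show "F \<otimes>\<^bsub>?L\<^esub> G = G \<otimes>\<^bsub>?L\<^esub> F"
        unfolding F(1) G(1) using F(2,3) G(2,3) sc tc by (simp add: fm m_comm)
      fix H assume "H \<in> carrier ?L"
      then obtain c r where H: "H = fraction R M c r" "c \<in> carrier R" "r \<in> M" using E by blast
      have rc: "r \<in> carrier R" using H Mc by auto
      show "F \<otimes>\<^bsub>?L\<^esub> G \<otimes>\<^bsub>?L\<^esub> H = F \<otimes>\<^bsub>?L\<^esub> (G \<otimes>\<^bsub>?L\<^esub> H)"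
        unfolding F(1) G(1) H(1) using F(2,3) G(2,3) H(2,3) sc tc rc by (simp add: fm m_assoc)
    qed
    fix F G H assume FGH: "F \<in> carrier ?L" "G \<in> carrier ?L" "H \<in> carrier ?L"
    obtain a s b t c r where F: "F = fraction R M a s" "a \<in> carrier R" "s \<in> M"
      and G: "G = fraction R M b t" "b \<in> carrier R" "t \<in> M"
      and H: "H = fraction R M c r" "c \<in> carrier R" "r \<in> M"
      using E[OF FGH(1)] E[OF FGH(2)] E[OF FGH(3)] by blast
    have sc: "s \<in> carrier R" "t \<in> carrier R" "r \<in> carrier R" using F G H Mc by auto
    have "((a \<otimes> t \<oplus> b \<otimes> s) \<otimes> c) \<otimes> ((s \<otimes> r) \<otimes> (t \<otimes> r))
        = ((a \<otimes> c) \<otimes> (t \<otimes> r) \<oplus> (b \<otimes> c) \<otimes> (s \<otimes> r)) \<otimes> ((s \<otimes> t) \<otimes> r)"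
      using F(2) G(2) H(2) sc by algebra
    then show "(F \<oplus>\<^bsub>?L\<^esub> G) \<otimes>\<^bsub>?L\<^esub> H = F \<otimes>\<^bsub>?L\<^esub> H \<oplus>\<^bsub>?L\<^esub> G \<otimes>\<^bsub>?L\<^esub> H"
      unfolding F(1) G(1) H(1) using F(2,3) G(2,3) H(2,3) sc
      by (simp add: fm fa) (rule fraction_eq_crossI, auto)
  qed
qed

lemma fraction_minus:
  assumes "a \<in> carrier R" "s \<in> M"
  shows "\<ominus>\<^bsub>localization R M\<^esub> fraction R M a s = fraction R M (\<ominus> a) s"
proof -
  interpret L: cring "localization R M" by (rule localization_cring)
  have sc: "s \<in> carrier R" using assms(2) submonoid.subset[OF M] by blast
  have "fraction R M (\<ominus> a) s \<oplus>\<^bsub>localization R M\<^esub> fraction R M a s = \<zero>\<^bsub>localization R M\<^esub>"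
    unfolding localization_one_zero using assms sc submonoid.m_closed[OF M] submonoid.one_closed[OF M]
    by (simp add: fraction_add[OF is_cring M]) (rule fraction_eq_crossI, auto simp: l_minus l_neg)
  then show ?thesis
    using assms by (intro L.minus_equality) (auto simp: localization_carrier)
qed

end

end

section \<open>Arithmetic extensions and saturated rings\<close>

lemma (in cring) subring_cring: "subring A R \<Longrightarrow> cring (R\<lparr>carrier := A\<rparr>)"
  using subcring_iff[OF subringE(1)] subcringI' by blast

locale localized_extension = cring +
  fixes A P
  assumes A: "subring A R" and P: "primeideal P (R\<lparr>carrier := A\<rparr>)"
begin

abbreviation (input) D where "D \<equiv> A - P"

lemma submonoid_D: "submonoid D R"
  by (rule prime_of_subringD(7)[OF A P])

abbreviation (input) L where "L \<equiv> localization R D"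

lemma local_ring_image:
  "loc_map R D ` carrier (local_ring_at (sub_as_ring R A) P) = {fraction R D r s | r s. r \<in> A \<and> s \<in> D}"
proof -
  have sub: "submonoid D (R\<lparr>carrier := A\<rparr>)"
    using prime_of_subringD(7)[OF A P] unfolding submonoid_def by auto
  have car: "carrier (local_ring_at (sub_as_ring R A) P)
      = {fraction (R\<lparr>carrier := A\<rparr>) D r s | r s. r \<in> A \<and> s \<in> D}"
    using cring.localization_carrier[OF subring_cring[OF A] sub]
    unfolding local_ring_at_def by simp
  note loc = loc_map_fraction[OF is_cring A submonoid_D subset_refl Diff_subset sub]
  show ?thesis
    unfolding car
  proof (intro equalityI subsetI)
    fix z assume "z \<in> loc_map R D ` {fraction (R\<lparr>carrier := A\<rparr>) D r s | r s. r \<in> A \<and> s \<in> D}"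
    then obtain r s where rs: "r \<in> A" "s \<in> D" "z = loc_map R D (fraction (R\<lparr>carrier := A\<rparr>) D r s)"
      by blast
    from rs(3) have "z = fraction R D r s" unfolding loc[OF rs(1,2)] .
    then show "z \<in> {fraction R D r s | r s. r \<in> A \<and> s \<in> D}" using rs(1,2) by blast
  next
    fix z assume "z \<in> {fraction R D r s | r s. r \<in> A \<and> s \<in> D}"
    then obtain r s where rs: "r \<in> A" "s \<in> D" "z = fraction R D r s" by blast
    from rs(3) have "z = loc_map R D (fraction (R\<lparr>carrier := A\<rparr>) D r s)" unfolding loc[OF rs(1,2)] .
    then show "z \<in> loc_map R D ` {fraction (R\<lparr>carrier := A\<rparr>) D r s | r s. r \<in> A \<and> s \<in> D}"
      using rs(1,2) by blast
  qed
qed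

lemma fractions_subring:
  assumes T: "subring T R" and "D \<subseteq> T"
  shows "subring {fraction R D x s | x s. x \<in> T \<and> s \<in> D} L" (is "subring ?F L")
proof -
  note Tc = subringE[OF T]
  interpret D: submonoid D R by (rule submonoid_D)
  interpret L: cring L by (rule localization_cring[OF submonoid_D])
  have I: "fraction R D x s \<in> ?F" if "x \<in> T" "s \<in> D" for x s using that by blast
  show ?thesis
  proof (rule L.subringI)
    show "?F \<subseteq> carrier L" using Tc(1) unfolding localization_carrier[OF submonoid_D] by blast
    show "\<one>\<^bsub>L\<^esub> \<in> ?F"
      unfolding localization_one_zero[OF submonoid_D] by (rule I[OF Tc(3) D.one_closed])
    fix h assume "h \<in> ?F"
    then obtain x s where h: "h = fraction R D x s" "x \<in> T" "s \<in> D" by blast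
    have c: "x \<in> carrier R" using h(2) Tc(1) by blast
    show "\<ominus>\<^bsub>L\<^esub> h \<in> ?F"
      unfolding h(1) fraction_minus[OF submonoid_D c h(3)] by (rule I[OF Tc(5)[OF h(2)] h(3)])
    fix k assume "k \<in> ?F"
    then obtain y t where k: "k = fraction R D y t" "y \<in> T" "t \<in> D" by blast
    have c': "y \<in> carrier R" using k(2) Tc(1) by blast
    show "h \<otimes>\<^bsub>L\<^esub> k \<in> ?F"
      unfolding h(1) k(1) fraction_mult[OF is_cring submonoid_D c h(3) c' k(3)]
      by (rule I[OF Tc(6)[OF h(2) k(2)] D.m_closed[OF h(3) k(3)]])
    have "x \<otimes> t \<oplus> y \<otimes> s \<in> T"
      using Tc(7)[OF Tc(6) Tc(6)] h k \<open>D \<subseteq> T\<close> by blast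
    then show "h \<oplus>\<^bsub>L\<^esub> k \<in> ?F"
      unfolding h(1) k(1) fraction_add[OF is_cring submonoid_D c h(3) c' k(3)]
      by (rule I[OF _ D.m_closed[OF h(3) k(3)]])
  qed
qed

text \<open>A ring between \<open>A\<^sub>P\<close> and \<open>R\<^sub>P\<close> contains the inverses of all denominators, so it is recovered from
the numerators that it contains.\<close>

lemma contraction_of_subring:
  assumes T: "subring T L" and base: "{fraction R D r s | r s. r \<in> A \<and> s \<in> D} \<subseteq> T"
  defines "T0 \<equiv> {x \<in> carrier R. fraction R D x \<one> \<in> T}"
  shows "T0 \<in> intermediate_rings R A" "saturated R D T0"
    and "T = {fraction R D x s | x s. x \<in> T0 \<and> s \<in> D}"
proof -
  note Ac = subringE[OF A] and Tc = subringE[OF T]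
  interpret D: submonoid D R by (rule submonoid_D)
  interpret L: cring L by (rule localization_cring[OF submonoid_D])
  note fm = fraction_mult[OF is_cring submonoid_D] and fa = fraction_add[OF is_cring submonoid_D]
  note one = D.one_closed
  have Dc: "s \<in> carrier R" if "s \<in> D" for s using that D.subset by blast
  have inv_mem: "fraction R D \<one> s \<in> T" if "s \<in> D" for s using base Ac(3) that by blast
  have num: "fraction R D (s \<otimes> x) \<one> = fraction R D s \<one> \<otimes>\<^bsub>L\<^esub> fraction R D x \<one>"
    if "s \<in> carrier R" "x \<in> carrier R" for s x
    using fm[OF that(1) one that(2) one] by simp
  have frac: "fraction R D x s = fraction R D x \<one> \<otimes>\<^bsub>L\<^esub> fraction R D \<one> s"
    if "s \<in> D" "x \<in> carrier R" for s x
    using fm[OF that(2) one one_closed that(1)] that Dc by simp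
  have cancel: "fraction R D s \<one> \<otimes>\<^bsub>L\<^esub> fraction R D x s = fraction R D x \<one>"
    if "s \<in> D" "x \<in> carrier R" for s x
  proof -
    have "fraction R D (s \<otimes> x) s = fraction R D x \<one>"
      using that Dc[OF that(1)]
      by (intro fraction_eq_crossI[OF submonoid_D _ that(1) that(2) one]) (auto simp: m_comm)
    then show ?thesis using fm[OF Dc[OF that(1)] one that(2,1)] Dc[OF that(1)] by simp
  qed
  have "subring T0 R"
  proof (rule subringI)
    show "T0 \<subseteq> carrier R" unfolding T0_def by auto
    show "\<one> \<in> T0" using inv_mem[OF one] unfolding T0_def by simp
    fix x assume x: "x \<in> T0"
    then have xc: "x \<in> carrier R" "fraction R D x \<one> \<in> T" unfolding T0_def by auto
    show "\<ominus> x \<in> T0"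
      using fraction_minus[OF submonoid_D xc(1) one] Tc(5)[OF xc(2)] xc(1) unfolding T0_def by simp
    fix y assume y: "y \<in> T0"
    then have yc: "y \<in> carrier R" "fraction R D y \<one> \<in> T" unfolding T0_def by auto
    show "x \<otimes> y \<in> T0"
      using num[OF xc(1) yc(1)] Tc(6)[OF xc(2) yc(2)] xc yc unfolding T0_def by simp
    show "x \<oplus> y \<in> T0"
      using fa[OF xc(1) one yc(1) one] Tc(7)[OF xc(2) yc(2)] xc yc unfolding T0_def by simp
  qed
  moreover have "A \<subseteq> T0"
    unfolding T0_def using base one Ac(1) by blast
  ultimately show "T0 \<in> intermediate_rings R A" unfolding intermediate_rings_def by simp
  show "saturated R D T0"
    unfolding saturated_def
  proof (intro ballI impI)
    fix x s assume x: "x \<in> carrier R" and s: "s \<in> D" and "s \<otimes> x \<in> T0"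
    then have "fraction R D (s \<otimes> x) \<one> \<in> T" unfolding T0_def by simp
    then have "fraction R D (s \<otimes> x) \<one> \<otimes>\<^bsub>L\<^esub> fraction R D \<one> s \<in> T"
      using Tc(6) inv_mem[OF s] by blast
    moreover have "fraction R D (s \<otimes> x) \<one> \<otimes>\<^bsub>L\<^esub> fraction R D \<one> s = fraction R D (s \<otimes> x) s"
      using frac[OF s, of "s \<otimes> x"] Dc[OF s] x by simp
    moreover have "fraction R D (s \<otimes> x) s = fraction R D x \<one>"
      using x Dc[OF s] by (intro fraction_eq_crossI[OF submonoid_D _ s x one]) (auto simp: m_comm)
    ultimately show "x \<in> T0" unfolding T0_def using x by simp
  qed
  show "T = {fraction R D x s | x s. x \<in> T0 \<and> s \<in> D}"
  proof (intro equalityI subsetI)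
    fix z assume z: "z \<in> T"
    then obtain x s where xs: "z = fraction R D x s" "x \<in> carrier R" "s \<in> D"
      using Tc(1) unfolding localization_carrier[OF submonoid_D] by blast
    have "fraction R D s \<one> \<in> T" using base one xs(3) by blast
    then have "fraction R D x \<one> \<in> T" using cancel[OF xs(3,2)] Tc(6) z xs(1) by metis
    then show "z \<in> {fraction R D x s | x s. x \<in> T0 \<and> s \<in> D}" using xs unfolding T0_def by blast
  next
    fix z assume "z \<in> {fraction R D x s | x s. x \<in> T0 \<and> s \<in> D}"
    then obtain x s where xs: "z = fraction R D x s" "x \<in> carrier R" "fraction R D x \<one> \<in> T" "s \<in> D"
      unfolding T0_def by blast
    then show "z \<in> T" using frac[OF xs(4,2)] Tc(6)[OF xs(3) inv_mem[OF xs(4)]] by simp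
  qed
qed

lemma saturation_subset_if_fractions_subset:
  assumes T: "subring T R" and U: "subring U R" "D \<subseteq> U"
    and sub: "{fraction R D x s | x s. x \<in> T \<and> s \<in> D} \<subseteq> {fraction R D x s | x s. x \<in> U \<and> s \<in> D}"
  shows "T \<subseteq> saturation R D U"
proof
  interpret D: submonoid D R by (rule submonoid_D)
  fix x assume x: "x \<in> T"
  then have xc: "x \<in> carrier R" using subringE(1)[OF T] by blast
  obtain y s where y: "fraction R D x \<one> = fraction R D y s" "y \<in> U" "s \<in> D"
    using sub x D.one_closed by blast
  have yc: "y \<in> carrier R" using y(2) subringE(1)[OF U(1)] by blast
  obtain u where u: "u \<in> D" "u \<otimes> (x \<otimes> s) = u \<otimes> (y \<otimes> \<one>)"
    using y fraction_eq_iff[OF submonoid_D xc D.one_closed yc y(3)] by blast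
  have c: "u \<in> carrier R" "s \<in> carrier R" using u(1) y(3) D.subset by auto
  have "(u \<otimes> s) \<otimes> x = u \<otimes> (x \<otimes> s)" using c xc by algebra
  also have "\<dots> = u \<otimes> y" using u(2) yc by simp
  also have "\<dots> \<in> U" using u(1) y(2) U(2) subringE(6)[OF U(1)] by blast
  finally show "x \<in> saturation R D U"
    unfolding saturation_def using xc D.m_closed[OF u(1) y(3)] by blast
qed

text \<open>Extension \<open>T \<mapsto> T\<^sub>P\<close> and contraction are order preserving, and they are inverse to each other between
the saturated rings over \<open>A\<close> and the rings over \<open>A\<^sub>P\<close>.\<close>

lemma localized_chain_iff:
  "subset.chain (intermediate_rings L (loc_map R D ` carrier (local_ring_at (sub_as_ring R A) P)))
      (intermediate_rings L (loc_map R D ` carrier (local_ring_at (sub_as_ring R A) P)))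
   \<longleftrightarrow> (\<forall>T\<in>intermediate_rings R A. \<forall>U\<in>intermediate_rings R A.
          saturated R D T \<longrightarrow> saturated R D U \<longrightarrow> T \<subseteq> U \<or> U \<subseteq> T)"
  (is "subset.chain ?I ?I \<longleftrightarrow> ?sat")
proof
  let ?B = "{fraction R D r s | r s. r \<in> A \<and> s \<in> D}"
  let ?F = "\<lambda>T. {fraction R D x s | x s. x \<in> T \<and> s \<in> D}"
  {
    assume ch: "subset.chain ?I ?I"
    show ?sat
    proof (intro ballI impI)
      fix T U assume T: "T \<in> intermediate_rings R A" "saturated R D T"
        and U: "U \<in> intermediate_rings R A" "saturated R D U"
      note T' = intermediate_ringsD[OF T(1)] and U' = intermediate_ringsD[OF U(1)]
      have F: "?F V \<in> ?I" if "subring V R" "A \<subseteq> V" for V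
      proof -
        have "subring (?F V) L" using fractions_subring[OF that(1)] that(2) by blast
        moreover have "?B \<subseteq> ?F V" using that(2) by blast
        ultimately show ?thesis unfolding local_ring_image intermediate_rings_def by simp
      qed
      have "D \<subseteq> T" "D \<subseteq> U" using T'(2) U'(2) by auto
      have "\<forall>V\<in>?I. \<forall>W\<in>?I. V \<subseteq> W \<or> W \<subseteq> V" using ch unfolding subset_chain_def by (rule conjunct2)
      from bspec[OF bspec[OF this F[OF T'(1,2)]] F[OF U'(1,2)]] show "T \<subseteq> U \<or> U \<subseteq> T"
      proof (elim disjE)
        assume "?F T \<subseteq> ?F U"
        then have "T \<subseteq> saturation R D U"
          by (rule saturation_subset_if_fractions_subset[OF T'(1) U'(1) \<open>D \<subseteq> U\<close>])
        then show ?thesis using saturation_least[OF subset_refl U(2)] by (blast intro: subset_trans)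
      next
        assume "?F U \<subseteq> ?F T"
        then have "U \<subseteq> saturation R D T"
          by (rule saturation_subset_if_fractions_subset[OF U'(1) T'(1) \<open>D \<subseteq> T\<close>])
        then show ?thesis using saturation_least[OF subset_refl T(2)] by (blast intro: subset_trans)
      qed
    qed
  next
    assume sat: ?sat
    show "subset.chain ?I ?I"
      unfolding subset_chain_def
    proof (intro conjI ballI subset_refl)
      fix T U assume "T \<in> ?I" "U \<in> ?I"
      then have T: "subring T L" "?B \<subseteq> T" and U: "subring U L" "?B \<subseteq> U"
        unfolding local_ring_image intermediate_rings_def by auto
      let ?T = "{x \<in> carrier R. fraction R D x \<one> \<in> T}" and ?U = "{x \<in> carrier R. fraction R D x \<one> \<in> U}"
      note cT = contraction_of_subring[OF T] and cU = contraction_of_subring[OF U]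
      have mono: "?F V \<subseteq> ?F W" if "V \<subseteq> W" for V W using that by blast
      have "?T \<subseteq> ?U \<or> ?U \<subseteq> ?T" using sat[rule_format, OF cT(1) cU(1) cT(2) cU(2)] .
      then show "T \<subseteq> U \<or> U \<subseteq> T"
      proof (elim disjE)
        assume "?T \<subseteq> ?U"
        from subset_trans[OF equalityD1[OF cT(3)] subset_trans[OF mono[OF this] equalityD2[OF cU(3)]]]
        show ?thesis ..
      next
        assume "?U \<subseteq> ?T"
        from subset_trans[OF equalityD1[OF cU(3)] subset_trans[OF mono[OF this] equalityD2[OF cT(3)]]]
        show ?thesis ..
      qed
    qed
  }
qed

end

lemma arithmetic_extension_iff_saturated:
  assumes "cring S" and "subring R S"
  shows "arithmetic_extension S R \<longleftrightarrow>
    (\<forall>P\<in>Spec (sub_as_ring S R).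
      \<forall>T\<in>intermediate_rings S R. \<forall>U\<in>intermediate_rings S R.
        saturated S (R - P) T \<longrightarrow> saturated S (R - P) U \<longrightarrow> T \<subseteq> U \<or> U \<subseteq> T)"
  unfolding arithmetic_extension_def Let_def
proof (rule ball_cong[OF refl])
  fix P assume "P \<in> Spec (sub_as_ring S R)"
  then have "primeideal P (sub_as_ring S R)" unfolding Spec_def by simp
  then have "localized_extension S R P"
    using assms by (intro localized_extension.intro localized_extension_axioms.intro)
  from localized_extension.localized_chain_iff[OF this] show "subset.chain
      (intermediate_rings (localization S (R - P))
        (loc_map S (R - P) ` carrier (local_ring_at (sub_as_ring S R) P)))
      (intermediate_rings (localization S (R - P))
        (loc_map S (R - P) ` carrier (local_ring_at (sub_as_ring S R) P)))
    \<longleftrightarrow> (\<forall>T\<in>intermediate_rings S R. \<forall>U\<in>intermediate_rings S R.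
        saturated S (R - P) T \<longrightarrow> saturated S (R - P) U \<longrightarrow> T \<subseteq> U \<or> U \<subseteq> T)" .
qed

text \<open>Distributivity can be tested at the primes of \<open>R\<close>: if \<open>x \<in> T \<inter> UV\<close> is not in
\<open>E = (T \<inter> U)(T \<inter> V)\<close>, then some prime \<open>P\<close> contains the ideal of all \<open>r\<close> with \<open>rx \<in> E\<close>. The saturations
of \<open>U\<close> and \<open>V\<close> at \<open>P\<close> are comparable, so the larger one contains \<open>UV\<close> and hence \<open>x\<close>, which gives an
\<open>s\<close> outside \<open>P\<close> with \<open>sx \<in> E\<close>.\<close>

lemma arithmetic_imp_distributive:
  assumes S: "cring S" and R: "subring R S" and arith: "arithmetic_extension S R"
  shows "distributive_extension S R"
  unfolding distributive_extension_def
proof (intro ballI)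
  interpret cring S by fact
  fix T U V assume T: "T \<in> intermediate_rings S R" and U: "U \<in> intermediate_rings S R"
    and V: "V \<in> intermediate_rings S R"
  have ring_S: "ring S" by (rule ring_axioms)
  note sup = compositum_is_supremum[OF ring_S]
  let ?E = "compositum S (T \<inter> U) (T \<inter> V)"
  have TU: "T \<inter> U \<in> intermediate_rings S R" and TV: "T \<inter> V \<in> intermediate_rings S R"
    using T U V subring_inter unfolding intermediate_rings_def by auto
  note E = sup[OF TU TV] and UV = sup[OF U V]
  note E' = intermediate_ringsD[OF E(1)]
  show "T \<inter> compositum S U V = ?E"
  proof (intro equalityI subsetI)
    fix x assume x: "x \<in> T \<inter> compositum S U V"
    have xc: "x \<in> carrier S" using x intermediate_ringsD(3)[OF T] by blast
    interpret A: cring "sub_as_ring S R" by (rule subring_cring[OF R])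
    define I where "I = {r \<in> R. r \<otimes>\<^bsub>S\<^esub> x \<in> ?E}"
    note Rc = subringE[OF R] and Ec = subringE[OF E'(1)]
    show "x \<in> ?E"
    proof (rule ccontr)
      assume neg: "x \<notin> ?E"
      have "ideal I (sub_as_ring S R)"
      proof (rule idealI[OF A.ring_axioms])
        have mult: "r \<otimes>\<^bsub>S\<^esub> i \<in> I" if "r \<in> R" "i \<in> I" for r i
        proof -
          have i: "i \<in> R" "i \<otimes>\<^bsub>S\<^esub> x \<in> ?E" using that(2) unfolding I_def by auto
          have "(r \<otimes>\<^bsub>S\<^esub> i) \<otimes>\<^bsub>S\<^esub> x = r \<otimes>\<^bsub>S\<^esub> (i \<otimes>\<^bsub>S\<^esub> x)"
            using that(1) i(1) Rc(1) xc by (intro m_assoc) auto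
          moreover have "r \<in> ?E" using that(1) E'(2) by blast
          ultimately show ?thesis using Ec(6) i Rc(6) that(1) unfolding I_def by simp
        qed
        show "subgroup I (add_monoid (sub_as_ring S R))"
        proof (rule A.add.subgroupI)
          show "I \<subseteq> carrier (sub_as_ring S R)" unfolding I_def by auto
          show "I \<noteq> {}" using Rc(2) Ec(2) xc unfolding I_def by force
          fix i assume i: "i \<in> I"
          then have iR: "i \<in> carrier (sub_as_ring S R)" unfolding I_def by simp
          have "\<ominus>\<^bsub>sub_as_ring S R\<^esub> i = (\<ominus>\<^bsub>sub_as_ring S R\<^esub> \<one>\<^bsub>S\<^esub>) \<otimes>\<^bsub>S\<^esub> i"
            using A.l_minus[OF A.one_closed iR] A.l_one[OF iR] by simp
          also have "\<dots> \<in> I" using A.a_inv_closed[OF A.one_closed] by (intro mult i) simp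
          finally show "\<ominus>\<^bsub>sub_as_ring S R\<^esub> i \<in> I" .
          fix j assume j: "j \<in> I"
          have "i \<in> carrier S" "j \<in> carrier S" using i j Rc(1) unfolding I_def by auto
          then have "(i \<oplus>\<^bsub>S\<^esub> j) \<otimes>\<^bsub>S\<^esub> x = i \<otimes>\<^bsub>S\<^esub> x \<oplus>\<^bsub>S\<^esub> j \<otimes>\<^bsub>S\<^esub> x" using xc by (simp add: l_distr)
          then show "i \<oplus>\<^bsub>sub_as_ring S R\<^esub> j \<in> I" using i j Rc(7) Ec(7) unfolding I_def by simp
        qed
        fix i r assume i: "i \<in> I" and r: "r \<in> carrier (sub_as_ring S R)"
        then show "r \<otimes>\<^bsub>sub_as_ring S R\<^esub> i \<in> I" using mult by simp
        moreover have "i \<in> carrier (sub_as_ring S R)" using i unfolding I_def by simp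
        ultimately show "i \<otimes>\<^bsub>sub_as_ring S R\<^esub> r \<in> I" using r A.m_comm by metis
      qed
      moreover have "submonoid {\<one>\<^bsub>S\<^esub>} (sub_as_ring S R)"
        using Rc(3) by unfold_locales auto
      moreover have "I \<inter> {\<one>\<^bsub>S\<^esub>} = {}" using neg xc unfolding I_def by auto
      ultimately obtain P where P: "primeideal P (sub_as_ring S R)" "I \<subseteq> P"
        by (rule A.exists_ideal_maximal_disjoint)
      have P_Spec: "P \<in> Spec (sub_as_ring S R)" using P(1) unfolding Spec_def by simp
      let ?D = "R - P"
      have D: "submonoid ?D S" using prime_of_subringD(7)[OF R P(1)] .
      have sat: "saturation S ?D W \<in> intermediate_rings S R" "W \<subseteq> saturation S ?D W"
        if "W \<in> intermediate_rings S R" for W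
      proof -
        note W = intermediate_ringsD[OF that]
        show "W \<subseteq> saturation S ?D W" using subset_saturation[OF D W(3)] .
        then show "saturation S ?D W \<in> intermediate_rings S R"
          using subring_saturation[OF D W(1)] W(2) unfolding intermediate_rings_def by blast
      qed
      have hit: False if W: "x \<in> saturation S ?D W" "T \<inter> W \<subseteq> ?E" for W
      proof -
        obtain s where s: "s \<in> ?D" "s \<otimes>\<^bsub>S\<^esub> x \<in> W" using W(1) unfolding saturation_def by blast
        have "s \<otimes>\<^bsub>S\<^esub> x \<in> T"
          using s(1) x intermediate_ringsD(2)[OF T] subringE(6)[OF intermediate_ringsD(1)[OF T]] by blast
        then have "s \<in> I" using s W(2) unfolding I_def by blast
        then show False using P(2) s(1) by blast
      qed
      have "saturation S ?D U \<subseteq> saturation S ?D V \<or> saturation S ?D V \<subseteq> saturation S ?D U"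
        using arith[unfolded arithmetic_extension_iff_saturated[OF S R], rule_format,
            OF P_Spec sat(1)[OF U] sat(1)[OF V] saturated_saturation[OF D] saturated_saturation[OF D]] .
      then show False
      proof
        assume "saturation S ?D U \<subseteq> saturation S ?D V"
        then have "compositum S U V \<subseteq> saturation S ?D V"
          using UV(4)[OF sat(1)[OF V]] sat(2)[OF U] sat(2)[OF V] by blast
        then show False using hit[of V] E(3) x by blast
      next
        assume "saturation S ?D V \<subseteq> saturation S ?D U"
        then have "compositum S U V \<subseteq> saturation S ?D U"
          using UV(4)[OF sat(1)[OF U]] sat(2)[OF U] sat(2)[OF V] by blast
        then show False using hit[of U] E(2) x by blast
      qed
    qed
  next
    fix x assume "x \<in> ?E"
    moreover have "?E \<subseteq> T" using E(4)[OF T] by blast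
    moreover have "?E \<subseteq> compositum S U V" using E(4)[OF UV(1)] UV(2,3) by blast
    ultimately show "x \<in> T \<inter> compositum S U V" by blast
  qed
qed

section \<open>Minimal covers at a residually trivial prime\<close>

text \<open>A maximal chain in the family is finite, and its least member is minimal in the family.\<close>

lemma FCP_imp_minimal:
  assumes "FCP_extension S R" and "F \<subseteq> intermediate_rings S R" and "F \<noteq> {}"
  shows "\<exists>T\<in>F. \<forall>U\<in>F. U \<subseteq> T \<longrightarrow> U = T"
proof -
  obtain C where C: "subset.maxchain F C" using subset.Hausdorff by blast
  then have ch: "subset.chain F C" by (rule subset.maxchain_imp_chain)
  then have "subset.chain (intermediate_rings S R) C"
    using assms(2) unfolding subset_chain_def by blast
  then have fin: "finite C" using assms(1) unfolding FCP_extension_def by blast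
  have max: "U \<in> C" if "U \<in> F" "\<forall>V\<in>C. U \<subseteq> V" for U
  proof -
    have "subset.chain F (insert U C)" using that ch by (simp add: subset_chain_insert)
    then show ?thesis using C unfolding subset.maxchain_def by blast
  qed
  have "C \<noteq> {}" using max assms(3) by blast
  then have min: "\<Inter>C \<in> C" using Inter_in_chain[OF fin _ ch] by blast
  then have "\<Inter>C \<in> F" using ch unfolding subset_chain_def by blast
  moreover have "U = \<Inter>C" if "U \<in> F" "U \<subseteq> \<Inter>C" for U
    using max[OF that(1)] that(2) by blast
  ultimately show ?thesis by blast
qed

text \<open>What subintegrality of \<open>R \<subseteq> S\<close> provides at a prime \<open>P = Q \<inter> R\<close>: the residue fields of \<open>P\<close> and \<open>Q\<close>
agree (\<open>residue\<close>), and \<open>Q\<close> is the only prime over \<open>P\<close>, which makes \<open>S\<^sub>P\<close> local with every element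
outside \<open>Q\<close> invertible (\<open>dominated\<close>). The complement of \<open>P\<close> in \<open>R\<close> is \<open>R - Q\<close>, so \<open>P\<close> itself need
not be named.\<close>

locale residually_trivial_prime = cring S for S (structure) +
  fixes R Q
  assumes subring_R: "subring R S"
    and prime_Q: "primeideal Q S"
    and integral: "integral_extension S R"
    and residue: "x \<in> carrier S \<Longrightarrow> \<exists>t\<in>R - Q. \<exists>r\<in>R. t \<otimes> x \<ominus> r \<in> Q"
    and dominated: "x \<in> carrier S - Q \<Longrightarrow> \<exists>y\<in>carrier S. y \<otimes> x \<in> R - Q"
begin

abbreviation (input) D where "D \<equiv> R - Q"

sublocale Q: primeideal Q S by (rule prime_Q)

lemma submonoid_D: "submonoid D S"
proof
  note Rc = subringE[OF subring_R]
  show "D \<subseteq> carrier S" using Rc(1) by blast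
  show "\<one> \<in> D" using Rc(3) Q.I_notcarr Q.one_imp_carrier by auto
  show "x \<otimes> y \<in> D" if "x \<in> D" "y \<in> D" for x y
    using that Rc(6)[of x y] Q.I_prime[of x y] subsetD[OF Rc(1)] by auto
qed

lemma intermediate_integral:
  assumes "W \<in> intermediate_rings S R" and "x \<in> carrier S"
  obtains n where "n > 0" "x [^] n \<in> power_span W x n"
proof -
  note W = intermediate_ringsD[OF assms(1)]
  obtain p where "p \<noteq> []" "hd p = \<one>" "set p \<subseteq> R" "eval p x = \<zero>"
    using integral assms(2) unfolding integral_extension_def by blast
  then show ?thesis using integral_imp_power_in_span[OF W(1) assms(2)] W(2) that by blast
qed

text \<open>Every localized intermediate ring is local, with maximal ideal cut out by \<open>Q\<close>: an inverse \<open>y\<close> of \<open>w\<close> in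
\<open>S\<^sub>P\<close> is integral over \<open>R\<close>, and an integral equation of degree \<open>k + 1\<close> multiplied by \<open>w\<^sup>k\<close> shows
that \<open>y\<close> lies in \<open>W\<^sub>P\<close>.\<close>

lemma unit_in_intermediate:
  assumes W: "W \<in> intermediate_rings S R" and w: "w \<in> W - Q"
  obtains v where "v \<in> W" "v \<otimes> w \<in> D"
proof -
  note W' = intermediate_ringsD[OF W]
  note Wc = subringE[OF W'(1)]
  interpret D: submonoid D S by (rule submonoid_D)
  have wc: "w \<in> carrier S" using w Wc(1) by blast
  obtain y where y: "y \<in> carrier S" "y \<otimes> w \<in> D" using dominated w wc by blast
  have wp: "w [^] k \<in> W" for k :: nat by (induction k) (use w Wc in auto)
  have tp: "(y \<otimes> w) [^] k \<in> D" for k :: nat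
    by (induction k) (use y in \<open>auto simp del: Diff_iff\<close>)
  \<comment> \<open>Each power \<open>y\<^sup>i\<close> with \<open>i \<le> k\<close> is cancelled by \<open>w\<^sup>k\<close> up to powers of \<open>yw \<in> R\<close>.\<close>
  have *: "z \<otimes> w [^] k \<in> W" if "z \<in> power_span W y (Suc k)" for z k
    using that
  proof (induction k arbitrary: z)
    case 0
    then obtain r where r: "r \<in> W" "z = r \<otimes> \<one> \<oplus> \<zero>" by auto
    moreover have "r \<in> carrier S" using r(1) Wc(1) by blast
    ultimately show ?case by simp
  next
    case (Suc k)
    then obtain r z' where z: "z = r \<otimes> y [^] (Suc k) \<oplus> z'" "r \<in> W" "z' \<in> power_span W y (Suc k)"
      unfolding power_span.simps(2)[of W y "Suc k"] by blast
    have c: "r \<in> carrier S" "z' \<in> carrier S"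
      using z Wc(1) power_span_carrier[OF W'(1) y(1)] by blast+
    have distrib: "(r \<otimes> b \<oplus> z') \<otimes> (c \<otimes> w) = r \<otimes> (b \<otimes> (c \<otimes> w)) \<oplus> (z' \<otimes> c) \<otimes> w"
      if "r \<in> carrier S" "z' \<in> carrier S" "w \<in> carrier S" "b \<in> carrier S" "c \<in> carrier S" for b c
      using that by algebra
    have "z \<otimes> w [^] (Suc k) = r \<otimes> (y [^] (Suc k) \<otimes> w [^] (Suc k)) \<oplus> (z' \<otimes> w [^] k) \<otimes> w"
    proof -
      have "z \<otimes> (w [^] k \<otimes> w) = r \<otimes> (y [^] (Suc k) \<otimes> (w [^] k \<otimes> w)) \<oplus> (z' \<otimes> w [^] k) \<otimes> w"
        unfolding z using c wc nat_pow_closed[OF y(1), of "Suc k"] nat_pow_closed[OF wc, of k]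
        by (rule distrib)
      then show ?thesis by simp
    qed
    also have "y [^] (Suc k) \<otimes> w [^] (Suc k) = (y \<otimes> w) [^] (Suc k)"
      using y(1) wc by (simp only: nat_pow_distrib)
    finally have "z \<otimes> w [^] (Suc k) = r \<otimes> (y \<otimes> w) [^] (Suc k) \<oplus> (z' \<otimes> w [^] k) \<otimes> w" .
    moreover have "(y \<otimes> w) [^] (Suc k) \<in> W" using tp[of "Suc k"] W'(2) by blast
    ultimately show ?case using Suc.IH[OF z(3)] z(2) w Wc(6,7) by simp
  qed
  obtain n where n: "n > 0" "y [^] n \<in> power_span W y n"
    using intermediate_integral[OF W y(1)] .
  then obtain k where k: "n = Suc k" using gr0_conv_Suc by blast
  have "y [^] n \<otimes> w [^] k \<in> W" using * n(2) unfolding k .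
  moreover have "(y [^] n \<otimes> w [^] k) \<otimes> w = (y \<otimes> w) [^] n"
    unfolding k using y(1) wc by (simp add: nat_pow_distrib m_ac)
  ultimately show ?thesis using that tp[of n] by auto
qed

text \<open>Since residue fields agree, an element of \<open>T\<close> outside \<open>W\<close> can be moved into \<open>Q\<close> by a denominator and
an element of \<open>R\<close>; saturation keeps it outside \<open>W\<close>.\<close>

lemma exists_in_prime_outside:
  assumes T: "T \<in> intermediate_rings S R" and W: "W \<in> intermediate_rings S R" "saturated S D W"
    and "\<not> T \<subseteq> W"
  obtains x where "x \<in> T" "x \<in> Q" "x \<notin> W"
proof -
  note T' = intermediate_ringsD[OF T] and W' = intermediate_ringsD[OF W(1)]
  note Tc = subringE[OF T'(1)] and Wc = subringE[OF W'(1)]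
  obtain y where y: "y \<in> T" "y \<notin> W" "y \<in> carrier S" using assms(4) T'(3) by blast
  obtain t r where tr: "t \<in> D" "r \<in> R" "t \<otimes> y \<ominus> r \<in> Q" using residue[OF y(3)] by blast
  have c: "t \<in> carrier S" "r \<in> carrier S" using tr W' by auto
  have "t \<otimes> y \<ominus> r \<in> T" 
    using tr y(1) T'(2) by (intro subring_minus_closed[OF T'(1)] Tc(6)) auto
  moreover have "t \<otimes> y \<ominus> r \<notin> W"
  proof
    assume "t \<otimes> y \<ominus> r \<in> W"
    then have "(t \<otimes> y \<ominus> r) \<oplus> r \<in> W" using tr W'(2) Wc(7) by blast
    moreover have "(t \<otimes> y \<ominus> r) \<oplus> r = t \<otimes> y" using c y(3) by algebra
    ultimately have "t \<otimes> y \<in> W" by simp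
    then show False using saturatedD[OF W(2)] tr(1) y by blast
  qed
  ultimately show ?thesis using that tr(3) by blast
qed

lemma saturation_intermediate:
  assumes "V \<in> intermediate_rings S R"
  shows "saturation S D V \<in> intermediate_rings S R"
  using intermediate_ringsD[OF assms] subring_saturation[OF submonoid_D, of V]
    subset_saturation[OF submonoid_D, of V]
  unfolding intermediate_rings_def by blast

text \<open>The covers of \<open>W\<close> in the lattice of saturated rings. The next lemmas show that \<open>W\<^sub>P \<subset> T\<^sub>P\<close> is ramified:
with \<open>M\<close> the maximal ideal of \<open>W\<^sub>P\<close> and \<open>N\<close> that of \<open>T\<^sub>P\<close>, they give \<open>MT\<^sub>P \<subseteq> W\<^sub>P\<close> and \<open>z\<^sup>2 \<in> W\<^sub>P\<close> for all \<open>z\<close>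
in \<open>N\<close>.\<close>

context
  fixes W T
  assumes W: "W \<in> intermediate_rings S R" "saturated S D W"
    and T: "T \<in> intermediate_rings S R" "saturated S D T"
    and WT: "W \<subset> T"
    and minimal: "\<And>V. \<lbrakk>V \<in> intermediate_rings S R; saturated S D V; W \<subset> V; V \<subseteq> T\<rbrakk> \<Longrightarrow> V = T"
begin

lemma minimal_cover_dichotomy:
  assumes V: "V \<in> intermediate_rings S R" "W \<subseteq> V" "V \<subseteq> T"
  shows "V = W \<or> T = saturation S D V"
proof -
  let ?V = "saturation S D V"
  note V' = intermediate_ringsD[OF V(1)]
  have "?V \<subseteq> T" using saturation_least V(3) T(2) by blast
  then show ?thesis
    using minimal[OF saturation_intermediate[OF V(1)] saturated_saturation[OF submonoid_D]]
      subset_saturation[OF submonoid_D V'(3)] V(2) by blast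
qed

text \<open>Minimality applied to the ring \<open>W + aT\<close>: either \<open>aT \<subseteq> W\<close> or \<open>T\<^sub>P = W\<^sub>P + aT\<^sub>P\<close>.\<close>

lemma minimal_cover_multiples:
  assumes a: "a \<in> T" and "u0 \<in> T" "a \<otimes> u0 \<notin> W" and y: "y \<in> T"
  obtains s w u where "s \<in> D" "w \<in> W" "u \<in> T" "s \<otimes> y = w \<oplus> a \<otimes> u"
proof -
  note T' = intermediate_ringsD[OF T(1)] and W' = intermediate_ringsD[OF W(1)]
  note Tc = subringE[OF T'(1)] and Wc = subringE[OF W'(1)]
  define V where "V = {w \<oplus> a \<otimes> u | w u. w \<in> W \<and> u \<in> T}"
  have ac: "a \<in> carrier S" using a T'(3) by blast
  have WV: "W \<subseteq> V"
  proof
    fix w assume "w \<in> W"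
    then have "w = w \<oplus> a \<otimes> \<zero>" using Wc(1) ac by auto
    then show "w \<in> V" unfolding V_def using \<open>w \<in> W\<close> Tc(2) by blast
  qed
  have "a \<otimes> u0 = \<zero> \<oplus> a \<otimes> u0" using ac assms(2) T'(3) by auto
  then have "a \<otimes> u0 \<in> V" unfolding V_def using Wc(2) assms(2) by blast
  moreover have "subring V S"
    unfolding V_def using subring_plus_multiples[OF W'(1) T'(1) _ a] WT by blast
  moreover have "V \<subseteq> T" unfolding V_def using a WT Tc(6,7) by blast
  moreover have "V \<in> intermediate_rings S R"
    using calculation WV W'(2) unfolding intermediate_rings_def by blast
  ultimately have "y \<in> saturation S D V"
    using minimal_cover_dichotomy WV assms(3) y by blast
  then show ?thesis using that unfolding saturation_def V_def by blast
qed

text \<open>This is Nakayama's lemma for \<open>T/W\<close>. If \<open>aT\<close> is not contained in \<open>W\<close>, then \<open>T = W + aT\<close> up to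
denominators, and likewise \<open>T\<close> is spanned over \<open>W\<close> by \<open>1, x, \<dots>, x\<^bsup>n-1\<^esup>\<close> for any \<open>x \<in> T\<close> outside \<open>W\<close>.
Writing the highest power \<open>x\<^sup>k\<close> as an element of \<open>W + aT\<close>, its coefficient on the right lies in \<open>Q\<close>,
so that \<open>x\<^sup>k\<close> can be eliminated. This continues down to the single generator \<open>1\<close>, giving \<open>T = W\<close>.\<close>

lemma minimal_cover_mult_prime:
  assumes a: "a \<in> W" "a \<in> Q" and u: "u \<in> T"
  shows "a \<otimes> u \<in> W"
proof (rule ccontr)
  assume neg: "a \<otimes> u \<notin> W"
  note T' = intermediate_ringsD[OF T(1)] and W' = intermediate_ringsD[OF W(1)]
  note Tc = subringE[OF T'(1)] and Wc = subringE[OF W'(1)]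
  interpret D: submonoid D S by (rule submonoid_D)
  obtain x where x: "x \<in> T" "x \<notin> W" using WT by blast
  then have xc: "x \<in> carrier S" using T'(3) by blast
  note psc = power_span_carrier[OF W'(1) xc]
  have aT: "a \<in> T" and ac: "a \<in> carrier S" using a WT W'(3) by auto
  define M where "M = (\<lambda>k. saturation S D (power_span W x k))"
  have step: "T \<subseteq> M k" if TM: "T \<subseteq> M (Suc k)" and "k > 0" for k
  proof
    have pc: "x [^] k \<in> carrier S" using xc by simp
    have "x [^] k \<in> T" by (induction k) (use x Tc in auto)
    then obtain s w v where s: "s \<in> D" "w \<in> W" "v \<in> T" "s \<otimes> x [^] k = w \<oplus> a \<otimes> v"
      using minimal_cover_multiples[OF aT u neg] by metis
    have "v \<in> M (Suc k)" using TM s(3) by blast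
    then obtain t b q where t: "t \<in> D" "b \<in> W" "q \<in> power_span W x k"
        "t \<otimes> v = b \<otimes> x [^] k \<oplus> q" and vc: "v \<in> carrier S"
      unfolding M_def saturation_def by auto
    have c: "s \<in> carrier S" "t \<in> carrier S" "w \<in> carrier S" "b \<in> carrier S" "q \<in> carrier S"
      using s t W' psc by auto
    \<comment> \<open>The coefficient of \<open>x\<^sup>k\<close> after collecting terms; it is a unit because \<open>a \<in> Q\<close>.\<close>
    define z where "z = t \<otimes> s \<ominus> a \<otimes> b"
    \<comment> \<open>The power \<open>x\<^sup>k\<close> enters only as a ring element \<open>p\<close>, which keeps the ring identities polynomial.\<close>
    have key: "z \<otimes> p = t \<otimes> w \<oplus> a \<otimes> q"
      if "p \<in> carrier S" "s \<otimes> p = w \<oplus> a \<otimes> v" "t \<otimes> v = b \<otimes> p \<oplus> q" for p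
    proof -
      have "z \<otimes> p = t \<otimes> (s \<otimes> p) \<ominus> a \<otimes> (b \<otimes> p)"
        unfolding z_def using c ac that(1) by algebra
      also have "t \<otimes> (s \<otimes> p) = t \<otimes> w \<oplus> a \<otimes> (t \<otimes> v)"
        unfolding that(2) using c vc ac by algebra
      also have "t \<otimes> w \<oplus> a \<otimes> (t \<otimes> v) \<ominus> a \<otimes> (b \<otimes> p) = t \<otimes> w \<oplus> a \<otimes> q"
        unfolding that(3) using c ac that(1) by algebra
      finally show ?thesis .
    qed
    have "z \<notin> Q"
    proof
      assume "z \<in> Q"
      then have "z \<oplus> a \<otimes> b \<in> Q" using Q.I_r_closed[OF a(2)] c by simp
      moreover have "z \<oplus> a \<otimes> b = t \<otimes> s" unfolding z_def using c ac by algebra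
      ultimately show False using D.m_closed[OF t(1) s(1)] by simp
    qed
    moreover have zW: "z \<in> W"
      unfolding z_def using s(1) t a W'(2) by (intro subring_minus_closed[OF W'(1)] Wc(6)) auto
    ultimately obtain e where e: "e \<in> W" "e \<otimes> z \<in> D"
      using unit_in_intermediate[OF W(1)] by blast
    have W_sub: "b \<in> power_span W x k" if "b \<in> W" for b
      using subset_power_span[OF W'(1) xc \<open>k > 0\<close>] that by blast
    have "t \<otimes> w \<oplus> a \<otimes> q \<in> power_span W x k"
    proof (rule power_span_add[OF W'(1) xc])
      show "t \<otimes> w \<in> power_span W x k" using t(1) s(2) W'(2) by (intro W_sub Wc(6)) auto
      show "a \<otimes> q \<in> power_span W x k" using power_span_scale[OF W'(1) xc a(1) t(3)] .
    qed
    then have "e \<otimes> (z \<otimes> x [^] k) \<in> power_span W x k"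
      unfolding key[OF pc s(4) t(4)] by (intro power_span_scale[OF W'(1) xc] e(1))
    moreover have "e \<otimes> (z \<otimes> x [^] k) = (e \<otimes> z) \<otimes> x [^] k"
      using subsetD[OF Wc(1) e(1)] subsetD[OF Wc(1) zW] pc by (simp add: m_assoc)
    ultimately have red: "(e \<otimes> z) \<otimes> x [^] k \<in> power_span W x k" by simp
    fix y assume "y \<in> T"
    then obtain r g h where r: "r \<in> D" "g \<in> W" "h \<in> power_span W x k"
        "r \<otimes> y = g \<otimes> x [^] k \<oplus> h" and yc: "y \<in> carrier S"
      using TM unfolding M_def saturation_def by auto
    have c': "r \<in> carrier S" "g \<in> carrier S" "h \<in> carrier S" "e \<otimes> z \<in> carrier S"
      using r e W' psc by auto
    have "((e \<otimes> z) \<otimes> r) \<otimes> y = g \<otimes> ((e \<otimes> z) \<otimes> x [^] k) \<oplus> (e \<otimes> z) \<otimes> h"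
      using c' pc yc r(4) by (simp add: m_assoc r_distr) (simp add: m_ac)
    also have "\<dots> \<in> power_span W x k"
      using power_span_scale[OF W'(1) xc r(2) red] power_span_scale[OF W'(1) xc _ r(3)] e(2) W'(2)
      by (intro power_span_add[OF W'(1) xc]) auto
    finally show "y \<in> M k"
      unfolding M_def saturation_def using D.m_closed[OF e(2) r(1)] yc by blast
  qed
  obtain n where n: "n > 0" "x [^] n \<in> power_span W x n"
    using intermediate_integral[OF W(1) xc] .
  have "T \<subseteq> M n"
  proof -
    have "W \<subseteq> power_span W x n" "x \<in> power_span W x n"
      using subset_power_span[OF W'(1) xc n(1)] subring_power_span[OF W'(1) xc n(2,1)] by auto
    moreover have "power_span W x n \<in> intermediate_rings S R"
      using subring_power_span[OF W'(1) xc n(2,1)] calculation W'(2)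
      unfolding intermediate_rings_def by auto
    moreover have "power_span W x n \<subseteq> T"
      using power_span_subset_subring[OF T'(1) _ x(1)] WT by blast
    ultimately show ?thesis using minimal_cover_dichotomy x(2) unfolding M_def by blast
  qed
  moreover obtain m where "n = Suc m" using n(1) gr0_conv_Suc by blast
  moreover have "T \<subseteq> M (Suc m) \<Longrightarrow> T \<subseteq> M (Suc 0)" for m
    by (induction m) (use step in auto)
  ultimately have "T \<subseteq> M (Suc 0)" by blast
  moreover have "power_span W x (Suc 0) \<subseteq> W" using Wc(1) by auto
  then have "M (Suc 0) \<subseteq> W" unfolding M_def using saturation_least W(2) by blast
  ultimately show False using WT by blast
qed

text \<open>Otherwise minimality gives \<open>sx = w + x\<^sup>2u\<close> with \<open>w \<in> Q \<inter> W\<close>, that is \<open>(s - xu)x = w\<close> with a unit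
\<open>s - xu\<close>. Then \<open>x\<close> lies in \<open>wT\<close> up to denominators, and \<open>wT \<subseteq> W\<close> by the previous lemma.\<close>

lemma minimal_cover_square:
  assumes x: "x \<in> T" "x \<in> Q"
  shows "x \<otimes> x \<in> W"
proof (rule ccontr)
  assume neg: "x \<otimes> x \<notin> W"
  note T' = intermediate_ringsD[OF T(1)] and W' = intermediate_ringsD[OF W(1)]
  note Tc = subringE[OF T'(1)] and Wc = subringE[OF W'(1)]
  have xc: "x \<in> carrier S" using x T'(3) by blast
  have "x \<otimes> x \<in> T" "(x \<otimes> x) \<otimes> \<one> \<notin> W" using x neg xc Tc(6) by auto
  then obtain s w u where s: "s \<in> D" "w \<in> W" "u \<in> T" "s \<otimes> x = w \<oplus> (x \<otimes> x) \<otimes> u"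
    using minimal_cover_multiples[OF _ Tc(3), of "x \<otimes> x" x] x(1) by metis
  have c: "s \<in> carrier S" "w \<in> carrier S" "u \<in> carrier S" using s T' W' by auto
  define z where "z = s \<ominus> x \<otimes> u"
  have w: "w = z \<otimes> x"
  proof -
    have "z \<otimes> x = s \<otimes> x \<ominus> (x \<otimes> x) \<otimes> u" unfolding z_def using c xc by algebra
    also have "\<dots> = w" unfolding s(4) using c xc by algebra
    finally show ?thesis by simp
  qed
  have sT: "s \<in> T" using s(1) T'(2) by blast
  have zT: "z \<in> T"
    unfolding z_def using sT s(3) x(1) by (intro subring_minus_closed[OF T'(1)] Tc(6)) auto
  then have zc: "z \<in> carrier S" using T'(3) by blast
  have wQ: "w \<in> Q" unfolding w using x(2) zc by (rule Q.I_l_closed)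
  have "z \<notin> Q"
  proof
    assume "z \<in> Q"
    then have "z \<oplus> x \<otimes> u \<in> Q" using Q.I_r_closed[OF x(2)] c(3) by simp
    moreover have "z \<oplus> x \<otimes> u = s" unfolding z_def using c xc by algebra
    ultimately show False using s(1) by simp
  qed
  then obtain v where v: "v \<in> T" "v \<otimes> z \<in> D"
    using unit_in_intermediate[OF T(1)] zT by blast
  have vc: "v \<in> carrier S" using v T'(3) by blast
  have "(v \<otimes> z) \<otimes> x = w \<otimes> v" unfolding w using vc zc xc by algebra
  also have "\<dots> \<in> W" using minimal_cover_mult_prime[OF s(2) wQ v(1)] .
  finally have "x \<in> W" using saturatedD[OF W(2)] v(2) xc by blast
  then show False using neg Wc(6) by blast
qed

end

definition minimal_saturated_cover where
  "minimal_saturated_cover W T \<longleftrightarrow> T \<in> intermediate_rings S R \<and> saturated S D T \<and> W \<subset> T \<and>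
     (\<forall>V\<in>intermediate_rings S R. saturated S D V \<and> W \<subset> V \<and> V \<subseteq> T \<longrightarrow> V = T)"

lemma exists_minimal_saturated_cover:
  assumes "FCP_extension S R" and "T \<in> intermediate_rings S R" "saturated S D T" "W \<subset> T"
  obtains T' where "minimal_saturated_cover W T'" "T' \<subseteq> T"
proof -
  let ?F = "{V \<in> intermediate_rings S R. saturated S D V \<and> W \<subset> V \<and> V \<subseteq> T}"
  have "?F \<subseteq> intermediate_rings S R" "?F \<noteq> {}" using assms(2-4) by auto
  then obtain T' where "T' \<in> ?F" "\<forall>U\<in>?F. U \<subseteq> T' \<longrightarrow> U = T'"
    using FCP_imp_minimal[OF assms(1)] by meson
  then have "minimal_saturated_cover W T'" "T' \<subseteq> T"
    using assms(2) unfolding minimal_saturated_cover_def by (auto dest: subset_trans)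
  then show ?thesis by (rule that)
qed

lemma minimal_cover_element:
  assumes W: "W \<in> intermediate_rings S R" "saturated S D W" and "minimal_saturated_cover W T"
  obtains x where "x \<in> T" "x \<in> Q" "x \<notin> W" "x \<otimes> x \<in> W \<inter> Q"
    "\<And>a. a \<in> W \<Longrightarrow> a \<in> Q \<Longrightarrow> a \<otimes> x \<in> W \<inter> Q"
proof -
  have T: "T \<in> intermediate_rings S R" "saturated S D T" "W \<subset> T"
    and min: "\<And>V. \<lbrakk>V \<in> intermediate_rings S R; saturated S D V; W \<subset> V; V \<subseteq> T\<rbrakk> \<Longrightarrow> V = T"
    using assms(3) unfolding minimal_saturated_cover_def by auto
  have "\<not> T \<subseteq> W" using T(3) by blast
  then obtain x where x: "x \<in> T" "x \<in> Q" "x \<notin> W" using exists_in_prime_outside[OF T(1) W] by blast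
  have xc: "x \<in> carrier S" using x(1) intermediate_ringsD(3)[OF T(1)] by blast
  show ?thesis
  proof (rule that[OF x])
    show "x \<otimes> x \<in> W \<inter> Q"
      using minimal_cover_square[OF W T min] x(1,2) Q.I_l_closed[OF x(2) xc] by blast
    show "a \<otimes> x \<in> W \<inter> Q" if "a \<in> W" "a \<in> Q" for a
      using minimal_cover_mult_prime[OF W T min] that x(1) Q.I_r_closed[OF that(2) xc] by blast
  qed
qed

context
  fixes W T U x y
  assumes W: "W \<in> intermediate_rings S R" "saturated S D W"
    and T: "T \<in> intermediate_rings S R" "saturated S D T"
    and U: "U \<in> intermediate_rings S R" "saturated S D U"
    and inter: "T \<inter> U = W"
    and x: "x \<in> T" "x \<in> Q" "x \<notin> W" "x \<otimes> x \<in> W \<inter> Q"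
      "\<And>a. a \<in> W \<Longrightarrow> a \<in> Q \<Longrightarrow> a \<otimes> x \<in> W \<inter> Q"
    and y: "y \<in> U" "y \<in> Q" "y \<notin> W" "y \<otimes> y \<in> W \<inter> Q"
      "\<And>a. a \<in> W \<Longrightarrow> a \<in> Q \<Longrightarrow> a \<otimes> y \<in> W \<inter> Q"
begin

text \<open>Over the residue field, either \<open>1, x, y, xy\<close> are linearly independent or \<open>xy = 0\<close> and \<open>1, x, y\<close> are.
In both cases \<open>y\<close> cannot occur with a unit coefficient \<open>\<gamma>\<close>: multiplying the relation by \<open>x\<close> kills all
terms but \<open>\<gamma>xy\<close> modulo \<open>W\<close>, so \<open>xy \<in> W\<close>, and then the relation puts \<open>\<gamma>y\<close> into \<open>T\<close>.\<close>

lemma cover_relation_coeff: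
  assumes W': "\<alpha> \<in> W" "\<beta> \<in> W" "\<gamma> \<in> W" "\<delta> \<in> W"
    and rel: "\<alpha> \<oplus> \<beta> \<otimes> x \<oplus> \<gamma> \<otimes> y \<oplus> \<delta> \<otimes> (x \<otimes> y) = \<zero>"
  shows "\<gamma> \<in> Q"
proof (rule ccontr)
  assume neg: "\<gamma> \<notin> Q"
  note Wc = subringE[OF intermediate_ringsD(1)[OF W(1)]]
  note Tc = subringE[OF intermediate_ringsD(1)[OF T(1)]]
  have WT: "W \<subseteq> T" using inter by blast
  have xy: "x \<in> carrier S" "y \<in> carrier S" using x(2) y(2) by auto
  have c: "\<alpha> \<in> carrier S" "\<beta> \<in> carrier S" "\<gamma> \<in> carrier S" "\<delta> \<in> carrier S" using W' Wc(1) by auto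
  obtain v where v: "v \<in> W" "v \<otimes> \<gamma> \<in> D" using unit_in_intermediate[OF W(1)] W'(3) neg by blast
  have vc: "v \<in> carrier S" using v Wc(1) by auto
  have "\<alpha> = (\<alpha> \<oplus> \<beta> \<otimes> x \<oplus> \<gamma> \<otimes> y \<oplus> \<delta> \<otimes> (x \<otimes> y)) \<oplus> (\<ominus> \<beta> \<ominus> \<delta> \<otimes> y) \<otimes> x \<oplus> (\<ominus> \<gamma>) \<otimes> y"
    using c xy by algebra
  then have "\<alpha> = (\<ominus> \<beta> \<ominus> \<delta> \<otimes> y) \<otimes> x \<oplus> (\<ominus> \<gamma>) \<otimes> y" unfolding rel using c xy by simp
  moreover have "\<dots> \<in> Q" using c xy x(2) y(2) by (intro Q.a_closed Q.I_l_closed) auto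
  ultimately have \<alpha>: "\<alpha> \<in> Q" by simp
  have "\<gamma> \<otimes> (x \<otimes> y) = (\<alpha> \<oplus> \<beta> \<otimes> x \<oplus> \<gamma> \<otimes> y \<oplus> \<delta> \<otimes> (x \<otimes> y)) \<otimes> x
      \<ominus> (\<alpha> \<otimes> x \<oplus> \<beta> \<otimes> (x \<otimes> x) \<oplus> \<delta> \<otimes> ((x \<otimes> x) \<otimes> y))"
    using c xy by algebra
  also have "\<dots> = \<zero> \<otimes> x \<ominus> (\<alpha> \<otimes> x \<oplus> \<beta> \<otimes> (x \<otimes> x) \<oplus> \<delta> \<otimes> ((x \<otimes> x) \<otimes> y))"
    by (simp only: rel)
  also have "\<dots> \<in> W"
  proof -
    have "\<zero> \<otimes> x \<in> W" using xy Wc(2) by simp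
    moreover have "\<alpha> \<otimes> x \<in> W" using x(5)[OF W'(1) \<alpha>] by blast
    moreover have "\<beta> \<otimes> (x \<otimes> x) \<in> W" using x(4) W'(2) Wc(6) by blast
    moreover have "\<delta> \<otimes> ((x \<otimes> x) \<otimes> y) \<in> W" using x(4) y(5)[of "x \<otimes> x"] W'(4) Wc(6) by blast
    ultimately show ?thesis
      by (intro subring_minus_closed[OF intermediate_ringsD(1)[OF W(1)]] Wc(7))
  qed
  finally have "v \<otimes> (\<gamma> \<otimes> (x \<otimes> y)) \<in> W" using v(1) Wc(6) by blast
  then have "(v \<otimes> \<gamma>) \<otimes> (x \<otimes> y) \<in> W" using c xy vc by (simp add: m_assoc)
  then have "x \<otimes> y \<in> W" using saturatedD[OF W(2) _ v(2)] xy by blast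
  moreover have "\<gamma> \<otimes> y = (\<alpha> \<oplus> \<beta> \<otimes> x \<oplus> \<gamma> \<otimes> y \<oplus> \<delta> \<otimes> (x \<otimes> y)) \<ominus> (\<alpha> \<oplus> \<beta> \<otimes> x \<oplus> \<delta> \<otimes> (x \<otimes> y))"
    using c xy by algebra
  ultimately have "x \<otimes> y \<in> W" "\<gamma> \<otimes> y = \<zero> \<ominus> (\<alpha> \<oplus> \<beta> \<otimes> x \<oplus> \<delta> \<otimes> (x \<otimes> y))" by (simp_all only: rel)
  moreover have "\<zero> \<ominus> (\<alpha> \<oplus> \<beta> \<otimes> x \<oplus> \<delta> \<otimes> (x \<otimes> y)) \<in> T"
  proof -
    have "\<alpha> \<in> T" "\<beta> \<otimes> x \<in> T" "\<delta> \<otimes> (x \<otimes> y) \<in> T"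
      using W' WT Tc(6)[of \<beta> x] Tc(6)[of \<delta> "x \<otimes> y"] x(1) calculation(1) by auto
    then show ?thesis
      by (intro subring_minus_closed[OF intermediate_ringsD(1)[OF T(1)]] Tc(2) Tc(7))
  qed
  ultimately have "\<gamma> \<otimes> y \<in> T" by simp
  then have "v \<otimes> (\<gamma> \<otimes> y) \<in> T" using v(1) WT Tc(6) by blast
  then have "(v \<otimes> \<gamma>) \<otimes> y \<in> T" using c xy vc by (simp add: m_assoc)
  then have "y \<in> T" using saturatedD[OF T(2) _ v(2)] xy by blast
  then show False using y(1,3) inter by blast
qed

end

end

section \<open>Distributivity forces chains\<close>

text \<open>Used for \<open>q = xy\<close> and \<open>p\<close> one of \<open>x\<close>, \<open>y\<close>, \<open>x + y\<close> and \<open>0\<close>; the square \<open>(x + y)\<^sup>2\<close> is the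
reason for allowing a multiple of \<open>q\<close> in \<open>p\<^sup>2\<close>.\<close>

lemma (in cring) subring_quadratic_span:
  assumes W: "subring W R" and p: "p \<in> carrier R" and q: "q \<in> carrier R"
    and pp: "p \<otimes> p = a0 \<oplus> c0 \<otimes> q" "a0 \<in> W" "c0 \<in> W" and pq: "p \<otimes> q \<in> W" and qq: "q \<otimes> q \<in> W"
  shows "subring {a \<oplus> b \<otimes> p \<oplus> c \<otimes> q | a b c. a \<in> W \<and> b \<in> W \<and> c \<in> W} R" (is "subring ?V R")
proof (rule subringI)
  note Wc = subringE[OF W]
  have 0: "a0 \<in> carrier R" "c0 \<in> carrier R" using pp Wc(1) by auto
  show "?V \<subseteq> carrier R" using Wc(1) p q by auto
  have "\<one> = \<one> \<oplus> \<zero> \<otimes> p \<oplus> \<zero> \<otimes> q" using p q by simp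
  then show "\<one> \<in> ?V" using Wc(2,3) by blast
  show "\<ominus> h \<in> ?V" if h: "h \<in> ?V" for h
  proof -
    obtain a b c where h: "h = a \<oplus> b \<otimes> p \<oplus> c \<otimes> q" "a \<in> W" "b \<in> W" "c \<in> W" using h by blast
    have "a \<in> carrier R" "b \<in> carrier R" "c \<in> carrier R" using h Wc(1) by auto
    then have "\<ominus> h = (\<ominus> a) \<oplus> (\<ominus> b) \<otimes> p \<oplus> (\<ominus> c) \<otimes> q" unfolding h(1) using p q by algebra
    then show ?thesis using h(2-4) Wc(5) by blast
  qed
  fix h h' assume "h \<in> ?V" "h' \<in> ?V"
  then obtain a b c a' b' c' where h: "h = a \<oplus> b \<otimes> p \<oplus> c \<otimes> q" "a \<in> W" "b \<in> W" "c \<in> W"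
    "h' = a' \<oplus> b' \<otimes> p \<oplus> c' \<otimes> q" "a' \<in> W" "b' \<in> W" "c' \<in> W" by blast
  have c: "a \<in> carrier R" "b \<in> carrier R" "c \<in> carrier R" "a' \<in> carrier R" "b' \<in> carrier R" "c' \<in> carrier R"
    using h Wc(1) by auto
  have "h \<oplus> h' = (a \<oplus> a') \<oplus> (b \<oplus> b') \<otimes> p \<oplus> (c \<oplus> c') \<otimes> q"
    unfolding h using c p q by algebra
  then show "h \<oplus> h' \<in> ?V" using h Wc(7) by blast
  have "h \<otimes> h' = (a \<otimes> a' \<oplus> (b \<otimes> c' \<oplus> c \<otimes> b') \<otimes> (p \<otimes> q) \<oplus> (c \<otimes> c') \<otimes> (q \<otimes> q))
      \<oplus> (a \<otimes> b' \<oplus> b \<otimes> a') \<otimes> p \<oplus> (a \<otimes> c' \<oplus> c \<otimes> a') \<otimes> q \<oplus> (b \<otimes> b') \<otimes> (p \<otimes> p)"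
    unfolding h using c p q by algebra
  also have "\<dots> = (a \<otimes> a' \<oplus> (b \<otimes> c' \<oplus> c \<otimes> b') \<otimes> (p \<otimes> q) \<oplus> (c \<otimes> c') \<otimes> (q \<otimes> q) \<oplus> (b \<otimes> b') \<otimes> a0)
      \<oplus> (a \<otimes> b' \<oplus> b \<otimes> a') \<otimes> p \<oplus> (a \<otimes> c' \<oplus> c \<otimes> a' \<oplus> (b \<otimes> b') \<otimes> c0) \<otimes> q"
  proof -
    have "A \<oplus> B \<otimes> p \<oplus> C \<otimes> q \<oplus> E \<otimes> (p \<otimes> p) = (A \<oplus> E \<otimes> a0) \<oplus> B \<otimes> p \<oplus> (C \<oplus> E \<otimes> c0) \<otimes> q"
      if "A \<in> carrier R" "B \<in> carrier R" "C \<in> carrier R" "E \<in> carrier R" for A B C E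
      unfolding pp(1) using that p q 0 by algebra
    then show ?thesis using c p q by simp
  qed
  finally have "h \<otimes> h' = (a \<otimes> a' \<oplus> (b \<otimes> c' \<oplus> c \<otimes> b') \<otimes> (p \<otimes> q) \<oplus> (c \<otimes> c') \<otimes> (q \<otimes> q) \<oplus> (b \<otimes> b') \<otimes> a0)
      \<oplus> (a \<otimes> b' \<oplus> b \<otimes> a') \<otimes> p \<oplus> (a \<otimes> c' \<oplus> c \<otimes> a' \<oplus> (b \<otimes> b') \<otimes> c0) \<otimes> q" .
  moreover have "a \<otimes> a' \<oplus> (b \<otimes> c' \<oplus> c \<otimes> b') \<otimes> (p \<otimes> q) \<oplus> (c \<otimes> c') \<otimes> (q \<otimes> q) \<oplus> (b \<otimes> b') \<otimes> a0 \<in> W"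
    "a \<otimes> b' \<oplus> b \<otimes> a' \<in> W" "a \<otimes> c' \<oplus> c \<otimes> a' \<oplus> (b \<otimes> b') \<otimes> c0 \<in> W"
    using h pp pq qq by (simp_all add: Wc(6,7))
  ultimately show "h \<otimes> h' \<in> ?V" by blast
qed

context residually_trivial_prime
begin

text \<open>The ring \<open>W[x + y, xy]\<close> meets each of \<open>W[x, xy]\<close> and \<open>W[y, xy]\<close> inside \<open>W + Wxy\<close>, because the
coefficient of \<open>x + y\<close> in a common element must lie in \<open>Q\<close>. But \<open>x + y\<close> also belongs to the
compositum of the other two rings, and not to \<open>W + Wxy\<close>. Adjoining \<open>xy\<close>
makes the argument the same whether or not \<open>xy\<close> already lies in \<open>W\<close>.\<close>

lemma cover_pair_contradicts_distributivity:
  assumes dist: "distributive_extension S R"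
    and W: "W \<in> intermediate_rings S R" "saturated S D W"
    and T: "T \<in> intermediate_rings S R" "saturated S D T"
    and U: "U \<in> intermediate_rings S R" "saturated S D U"
    and inter: "T \<inter> U = W"
    and x: "x \<in> T" "x \<in> Q" "x \<notin> W" "x \<otimes> x \<in> W \<inter> Q"
      "\<And>a. a \<in> W \<Longrightarrow> a \<in> Q \<Longrightarrow> a \<otimes> x \<in> W \<inter> Q"
    and y: "y \<in> U" "y \<in> Q" "y \<notin> W" "y \<otimes> y \<in> W \<inter> Q"
      "\<And>a. a \<in> W \<Longrightarrow> a \<in> Q \<Longrightarrow> a \<otimes> y \<in> W \<inter> Q"
  shows False
proof -
  note W' = intermediate_ringsD[OF W(1)]
  note Wc = subringE[OF W'(1)]
  have c: "x \<in> carrier S" "y \<in> carrier S" using x(2) y(2) by auto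
  have inter': "U \<inter> T = W" using inter by blast
  note coeff_y = cover_relation_coeff[OF W T U inter x y]
  have coeff_x: "\<beta> \<in> Q"
    if "\<alpha> \<in> W" "\<beta> \<in> W" "\<gamma> \<in> W" "\<delta> \<in> W"
      and rel: "\<alpha> \<oplus> \<beta> \<otimes> x \<oplus> \<gamma> \<otimes> y \<oplus> \<delta> \<otimes> (x \<otimes> y) = \<zero>" for \<alpha> \<beta> \<gamma> \<delta>
  proof (rule cover_relation_coeff[OF W U T inter' y x that(1,3,2,4)])
    have "\<alpha> \<in> carrier S" "\<beta> \<in> carrier S" "\<gamma> \<in> carrier S" "\<delta> \<in> carrier S" using that Wc(1) by auto
    then have "\<alpha> \<oplus> \<gamma> \<otimes> y \<oplus> \<beta> \<otimes> x \<oplus> \<delta> \<otimes> (y \<otimes> x) = \<alpha> \<oplus> \<beta> \<otimes> x \<oplus> \<gamma> \<otimes> y \<oplus> \<delta> \<otimes> (x \<otimes> y)"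
      using c by algebra
    then show "\<alpha> \<oplus> \<gamma> \<otimes> y \<oplus> \<beta> \<otimes> x \<oplus> \<delta> \<otimes> (y \<otimes> x) = \<zero>" unfolding rel .
  qed
  define q where "q = x \<otimes> y"
  have qc: "q \<in> carrier S" unfolding q_def using c by simp
  define span where "span = (\<lambda>p. {a \<oplus> b \<otimes> p \<oplus> c \<otimes> q | a b c. a \<in> W \<and> b \<in> W \<and> c \<in> W})"
  have xxy: "(x \<otimes> x) \<otimes> y \<in> W" and yyx: "(y \<otimes> y) \<otimes> x \<in> W"
    using x(4) y(5) y(4) x(5) by blast+
  have "q \<otimes> q = (x \<otimes> x) \<otimes> (y \<otimes> y)" unfolding q_def using c by algebra
  then have qq: "q \<otimes> q \<in> W" using x(4) y(4) Wc(6) by simp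
  have "x \<otimes> q = (x \<otimes> x) \<otimes> y" "y \<otimes> q = (y \<otimes> y) \<otimes> x"
    "(x \<oplus> y) \<otimes> q = (x \<otimes> x) \<otimes> y \<oplus> (y \<otimes> y) \<otimes> x"
    unfolding q_def using c by algebra+
  then have pq: "x \<otimes> q \<in> W" "y \<otimes> q \<in> W" "(x \<oplus> y) \<otimes> q \<in> W"
    using xxy yyx Wc(7) by auto
  have "subring (span x) S"
    unfolding span_def
  proof (rule subring_quadratic_span[OF W'(1) c(1) qc _ _ Wc(2) pq(1) qq])
    show "x \<otimes> x = x \<otimes> x \<oplus> \<zero> \<otimes> q" using c qc by simp
  qed (use x(4) in blast)
  moreover have "subring (span y) S"
    unfolding span_def
  proof (rule subring_quadratic_span[OF W'(1) c(2) qc _ _ Wc(2) pq(2) qq])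
    show "y \<otimes> y = y \<otimes> y \<oplus> \<zero> \<otimes> q" using c qc by simp
  qed (use y(4) in blast)
  moreover have "subring (span (x \<oplus> y)) S"
    unfolding span_def
  proof (rule subring_quadratic_span[OF W'(1) _ qc _ _ _ pq(3) qq])
    show "(x \<oplus> y) \<otimes> (x \<oplus> y) = (x \<otimes> x \<oplus> y \<otimes> y) \<oplus> (\<one> \<oplus> \<one>) \<otimes> q"
      unfolding q_def using c by algebra
  qed (use x(4) y(4) c Wc(3,7) in auto)
  moreover have sub0: "subring (span \<zero>) S"
    unfolding span_def
  proof (rule subring_quadratic_span[OF W'(1) zero_closed qc _ Wc(2,2) _ qq])
    show "\<zero> \<otimes> \<zero> = \<zero> \<oplus> \<zero> \<otimes> q" "\<zero> \<otimes> q \<in> W" using qc Wc(2) by auto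
  qed
  moreover have sub: "W \<subseteq> span p" "p \<in> span p" if p: "p \<in> carrier S" for p
  proof
    fix w assume w: "w \<in> W"
    then have "w = w \<oplus> \<zero> \<otimes> p \<oplus> \<zero> \<otimes> q" using p qc Wc(1) by auto
    then show "w \<in> span p" unfolding span_def using w Wc(2) by blast
  next
    have "p = \<zero> \<oplus> \<one> \<otimes> p \<oplus> \<zero> \<otimes> q" using p qc by simp
    then show "p \<in> span p" unfolding span_def using Wc(2,3) by blast
  qed
  ultimately have I: "span x \<in> intermediate_rings S R" "span y \<in> intermediate_rings S R"
      "span (x \<oplus> y) \<in> intermediate_rings S R" "span \<zero> \<in> intermediate_rings S R"
    using W'(2) c unfolding intermediate_rings_def by (auto simp: subset_iff)
  have absorb: "b \<otimes> (x \<oplus> y) \<in> W" if "b \<in> W" "b \<in> Q" for b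
    using x(5)[OF that] y(5)[OF that] c that Wc(1,7) by (auto simp: r_distr)
  \<comment> \<open>The set \<open>span 0\<close> is \<open>W + Wxy\<close>.\<close>
  have red: "z \<in> span \<zero>"
    if z: "z = a \<oplus> b \<otimes> (x \<oplus> y) \<oplus> d \<otimes> q" "a \<in> W" "b \<in> W" "d \<in> W" and b: "b \<in> Q" for z a b d
  proof -
    have "a \<oplus> b \<otimes> (x \<oplus> y) \<in> W" using absorb z b Wc(7) by blast
    moreover have "z = (a \<oplus> b \<otimes> (x \<oplus> y)) \<oplus> \<zero> \<otimes> \<zero> \<oplus> d \<otimes> q"
      using z(1) calculation Wc(1) by auto
    ultimately show ?thesis unfolding span_def using z(4) Wc(2) by blast
  qed
  have sx: "span (x \<oplus> y) \<inter> span x \<subseteq> span \<zero>"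
  proof
    fix z assume "z \<in> span (x \<oplus> y) \<inter> span x"
    then obtain a b d a' b' d' where
      z: "z = a \<oplus> b \<otimes> (x \<oplus> y) \<oplus> d \<otimes> q" "a \<in> W" "b \<in> W" "d \<in> W" and
      z': "z = a' \<oplus> b' \<otimes> x \<oplus> d' \<otimes> q" "a' \<in> W" "b' \<in> W" "d' \<in> W"
      unfolding span_def by blast
    have wc: "a \<in> carrier S" "b \<in> carrier S" "d \<in> carrier S" "a' \<in> carrier S" "b' \<in> carrier S" "d' \<in> carrier S"
      using z z' Wc(1) by auto
    have "(a \<ominus> a') \<oplus> (b \<ominus> b') \<otimes> x \<oplus> b \<otimes> y \<oplus> (d \<ominus> d') \<otimes> (x \<otimes> y)
        = (a \<oplus> b \<otimes> (x \<oplus> y) \<oplus> d \<otimes> q) \<ominus> (a' \<oplus> b' \<otimes> x \<oplus> d' \<otimes> q)"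
      unfolding q_def using wc c by algebra
    also have "\<dots> = z \<ominus> z" by (simp only: z(1)[symmetric] z'(1)[symmetric])
    also have "\<dots> = \<zero>" unfolding z(1) using wc c qc by (simp add: a_minus_def r_neg)
    finally have "b \<in> Q"
      using coeff_y[of "a \<ominus> a'" "b \<ominus> b'" b "d \<ominus> d'"] z z' subring_minus_closed[OF W'(1)] by blast
    then show "z \<in> span \<zero>" using red z by blast
  qed
  have sy: "span (x \<oplus> y) \<inter> span y \<subseteq> span \<zero>"
  proof
    fix z assume "z \<in> span (x \<oplus> y) \<inter> span y"
    then obtain a b d a' b' d' where
      z: "z = a \<oplus> b \<otimes> (x \<oplus> y) \<oplus> d \<otimes> q" "a \<in> W" "b \<in> W" "d \<in> W" and
      z': "z = a' \<oplus> b' \<otimes> y \<oplus> d' \<otimes> q" "a' \<in> W" "b' \<in> W" "d' \<in> W"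
      unfolding span_def by blast
    have wc: "a \<in> carrier S" "b \<in> carrier S" "d \<in> carrier S" "a' \<in> carrier S" "b' \<in> carrier S" "d' \<in> carrier S"
      using z z' Wc(1) by auto
    have "(a \<ominus> a') \<oplus> b \<otimes> x \<oplus> (b \<ominus> b') \<otimes> y \<oplus> (d \<ominus> d') \<otimes> (x \<otimes> y)
        = (a \<oplus> b \<otimes> (x \<oplus> y) \<oplus> d \<otimes> q) \<ominus> (a' \<oplus> b' \<otimes> y \<oplus> d' \<otimes> q)"
      unfolding q_def using wc c by algebra
    also have "\<dots> = z \<ominus> z" by (simp only: z(1)[symmetric] z'(1)[symmetric])
    also have "\<dots> = \<zero>" unfolding z(1) using wc c qc by (simp add: a_minus_def r_neg)
    finally have "b \<in> Q"
      using coeff_x[of "a \<ominus> a'" b "b \<ominus> b'" "d \<ominus> d'"] z z' subring_minus_closed[OF W'(1)] by blast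
    then show "z \<in> span \<zero>" using red z by blast
  qed
  have ring_S: "ring S" by unfold_locales
  note comp = compositum_is_supremum[OF ring_S]
  have "x \<oplus> y \<in> compositum S (span x) (span y)"
    using subringE(7)[OF intermediate_ringsD(1)[OF comp(1)[OF I(1,2)]]]
      subsetD[OF comp(2)[OF I(1,2)] sub(2)[OF c(1)]] subsetD[OF comp(3)[OF I(1,2)] sub(2)[OF c(2)]] .
  then have "x \<oplus> y \<in> span (x \<oplus> y) \<inter> compositum S (span x) (span y)"
    using sub(2)[of "x \<oplus> y"] c by simp
  then have "x \<oplus> y \<in> compositum S (span (x \<oplus> y) \<inter> span x) (span (x \<oplus> y) \<inter> span y)"
    using dist[unfolded distributive_extension_def, rule_format, OF I(3,1,2)] by simp
  also have "\<dots> \<subseteq> span \<zero>"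
    unfolding compositum_def
  proof (rule generate_ring_min_subring1[OF _ sub0])
    show "span (x \<oplus> y) \<inter> span x \<union> span (x \<oplus> y) \<inter> span y \<subseteq> span \<zero>" using sx sy by simp
    then show "span (x \<oplus> y) \<inter> span x \<union> span (x \<oplus> y) \<inter> span y \<subseteq> carrier S"
      using subringE(1)[OF sub0] by (rule subset_trans)
  qed
  finally obtain a b d where e: "x \<oplus> y = a \<oplus> b \<otimes> \<zero> \<oplus> d \<otimes> q" "a \<in> W" "b \<in> W" "d \<in> W"
    unfolding span_def by blast
  have wc: "a \<in> carrier S" "b \<in> carrier S" "d \<in> carrier S" using e Wc(1) by auto
  have "\<ominus> a \<oplus> \<one> \<otimes> x \<oplus> \<one> \<otimes> y \<oplus> (\<ominus> d) \<otimes> (x \<otimes> y) = (x \<oplus> y) \<ominus> (a \<oplus> b \<otimes> \<zero> \<oplus> d \<otimes> q)"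
    unfolding q_def using wc c by algebra
  also have "\<dots> = \<zero>" unfolding e(1)[symmetric] using c by (simp add: a_minus_def r_neg)
  finally have "\<one> \<in> Q" using coeff_y[of "\<ominus> a" \<one> \<one> "\<ominus> d"] e Wc(3,5) by blast
  then show False using Q.I_notcarr Q.one_imp_carrier by blast
qed

text \<open>Incomparable \<open>T\<close> and \<open>U\<close> contain minimal covers of \<open>T \<inter> U\<close>, whose ramified generators are the \<open>x\<close>
and \<open>y\<close> of the previous lemma.\<close>

lemma distributive_saturated_comparable:
  assumes dist: "distributive_extension S R" and fcp: "FCP_extension S R"
    and T: "T \<in> intermediate_rings S R" "saturated S D T"
    and U: "U \<in> intermediate_rings S R" "saturated S D U"
  shows "T \<subseteq> U \<or> U \<subseteq> T"
proof (rule ccontr)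
  assume incomparable: "\<not> (T \<subseteq> U \<or> U \<subseteq> T)"
  define W where "W = T \<inter> U"
  have W: "W \<in> intermediate_rings S R" "saturated S D W"
    using T U subring_inter saturated_Int unfolding W_def intermediate_rings_def by auto
  have "W \<subset> T" "W \<subset> U" using incomparable unfolding W_def by auto
  obtain T' where T': "minimal_saturated_cover W T'" "T' \<subseteq> T"
    using exists_minimal_saturated_cover[OF fcp T \<open>W \<subset> T\<close>] .
  obtain U' where U': "minimal_saturated_cover W U'" "U' \<subseteq> U"
    using exists_minimal_saturated_cover[OF fcp U \<open>W \<subset> U\<close>] .
  obtain x where x: "x \<in> T'" "x \<in> Q" "x \<notin> W" "x \<otimes> x \<in> W \<inter> Q"
      "\<And>a. a \<in> W \<Longrightarrow> a \<in> Q \<Longrightarrow> a \<otimes> x \<in> W \<inter> Q"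
    using minimal_cover_element[OF W T'(1)] by metis
  obtain y where y: "y \<in> U'" "y \<in> Q" "y \<notin> W" "y \<otimes> y \<in> W \<inter> Q"
      "\<And>a. a \<in> W \<Longrightarrow> a \<in> Q \<Longrightarrow> a \<otimes> y \<in> W \<inter> Q"
    using minimal_cover_element[OF W U'(1)] by metis
  show False
    using cover_pair_contradicts_distributivity[OF dist W T U W_def[symmetric] _ x(2-5) _ y(2-5)]
      x(1) y(1) T'(2) U'(2) by blast
qed

end

section \<open>Primes of a subintegral extension\<close>

context cring
begin

lemma ext_prime_eq:
  assumes P: "primeideal P R"
  shows "ext_prime R P = {fraction R (carrier R - P) p s | p s. p \<in> P \<and> s \<in> carrier R - P}"
    (is "_ = ?E") and "ideal (ext_prime R P) (local_ring_at R P)"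
proof -
  let ?D = "carrier R - P"
  let ?L = "localization R ?D"
  interpret P: primeideal P R by fact
  have "primeideal P (R\<lparr>carrier := carrier R\<rparr>)" using P by simp
  note Pc = prime_of_subringD[OF carrier_is_subring this]
  have D: "submonoid ?D R" by (rule Pc(7))
  interpret D: submonoid ?D R by (rule D)
  interpret L: cring ?L by (rule localization_cring[OF D])
  note fm = fraction_mult[OF is_cring D] and fa = fraction_add[OF is_cring D]
  have Pcar: "p \<in> carrier R" if "p \<in> P" for p using that by (rule P.Icarr)
  have Dcar: "s \<in> carrier R" if "s \<in> ?D" for s using that by blast
  have I: "fraction R ?D p s \<in> ?E" if "p \<in> P" "s \<in> ?D" for p s using that by blast
  have idl: "ideal ?E ?L"
  proof (rule idealI[OF L.ring_axioms])
    show "subgroup ?E (add_monoid ?L)"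
    proof (rule L.add.subgroupI)
      show "?E \<subseteq> carrier ?L" using Pcar unfolding localization_carrier[OF D] by blast
      show "?E \<noteq> {}" using Pc(2) D.one_closed by blast
      fix h assume "h \<in> ?E"
      then obtain p s where h: "h = fraction R ?D p s" "p \<in> P" "s \<in> ?D" by blast
      have "\<ominus> p = \<ominus> \<one> \<otimes> p" using Pcar[OF h(2)] by (simp add: l_minus)
      then have "\<ominus> p \<in> P" using Pc(5)[of "\<ominus> \<one>" p] h(2) by simp
      then show "\<ominus>\<^bsub>?L\<^esub> h \<in> ?E"
        unfolding h(1) fraction_minus[OF D Pcar[OF h(2)] h(3)] by (rule I[OF _ h(3)])
      fix k assume "k \<in> ?E"
      then obtain q t where k: "k = fraction R ?D q t" "q \<in> P" "t \<in> ?D" by blast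
      have "p \<otimes> t \<oplus> q \<otimes> s \<in> P"
        using Pc(4) P.I_r_closed[OF h(2) Dcar[OF k(3)]] P.I_r_closed[OF k(2) Dcar[OF h(3)]] by blast
      then show "h \<oplus>\<^bsub>?L\<^esub> k \<in> ?E"
        unfolding h(1) k(1) fa[OF Pcar[OF h(2)] h(3) Pcar[OF k(2)] k(3)]
        by (rule I[OF _ D.m_closed[OF h(3) k(3)]])
    qed
    fix h z assume "h \<in> ?E" and z: "z \<in> carrier ?L"
    then obtain p s where h: "h = fraction R ?D p s" "p \<in> P" "s \<in> ?D" by blast
    obtain a t where a: "z = fraction R ?D a t" "a \<in> carrier R" "t \<in> ?D"
      using z unfolding localization_carrier[OF D] by blast
    show 1: "z \<otimes>\<^bsub>?L\<^esub> h \<in> ?E"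
      unfolding h(1) a(1) fm[OF a(2,3) Pcar[OF h(2)] h(3)]
      by (rule I[OF P.I_l_closed[OF h(2) a(2)] D.m_closed[OF a(3) h(3)]])
    have "h \<in> carrier ?L" using h Pcar unfolding localization_carrier[OF D] by blast
    then show "h \<otimes>\<^bsub>?L\<^esub> z \<in> ?E" using 1 L.m_comm[OF z] by simp
  qed
  have gen: "(\<lambda>p. fraction R ?D p \<one>) ` P \<subseteq> carrier ?L"
    using Pcar D.one_closed unfolding localization_carrier[OF D] by blast
  have def: "ext_prime R P = genideal ?L ((\<lambda>p. fraction R ?D p \<one>) ` P)"
    unfolding ext_prime_def local_ring_at_def ..
  have ext: "ideal (ext_prime R P) ?L" unfolding def by (rule L.genideal_ideal[OF gen])
  show "ideal (ext_prime R P) (local_ring_at R P)" using ext unfolding local_ring_at_def .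
  show "ext_prime R P = ?E"
  proof
    have "(\<lambda>p. fraction R ?D p \<one>) ` P \<subseteq> ?E" using D.one_closed by blast
    then show "ext_prime R P \<subseteq> ?E" unfolding def by (rule L.genideal_minimal[OF idl])
    show "?E \<subseteq> ext_prime R P"
    proof
      fix z assume "z \<in> ?E"
      then obtain p s where z: "z = fraction R ?D p s" "p \<in> P" "s \<in> ?D" by blast
      have "fraction R ?D p \<one> \<in> ext_prime R P"
        unfolding def using L.genideal_self[OF gen] z(2) by blast
      moreover have "fraction R ?D \<one> s \<in> carrier ?L"
        using z(3) unfolding localization_carrier[OF D] by blast
      ultimately have "fraction R ?D p \<one> \<otimes>\<^bsub>?L\<^esub> fraction R ?D \<one> s \<in> ext_prime R P"
        by (rule ideal.I_r_closed[OF ext])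
      then show "z \<in> ext_prime R P"
        unfolding fm[OF Pcar[OF z(2)] D.one_closed one_closed z(3)] z(1)
        using Pcar[OF z(2)] Dcar[OF z(3)] by simp
    qed
  qed
qed

text \<open>The residual map is defined by representatives, so its value is known only after checking that
the canonical map of local rings carries the extended prime of \<open>Q \<inter> A\<close> into that of \<open>Q\<close>. Surjectivity
then gives \<open>x \<equiv> r/t\<close> modulo \<open>QR\<^sub>Q\<close>, and clearing denominators in the prime \<open>Q\<close> gives the claim.\<close>

lemma residual_surjective_imp_representative:
  assumes A: "subring A R" and Q: "primeideal Q R" and P: "primeideal (Q \<inter> A) (R\<lparr>carrier := A\<rparr>)"
    and surj: "carrier (residue_field R Q)
      \<subseteq> residual_map R Q ` carrier (residue_field (R\<lparr>carrier := A\<rparr>) (Q \<inter> A))"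
    and x: "x \<in> carrier R"
  shows "\<exists>t\<in>A - Q. \<exists>r\<in>A. t \<otimes> x \<ominus> r \<in> Q"
proof -
  let ?B = "R\<lparr>carrier := A\<rparr>" and ?P = "Q \<inter> A"
  let ?M = "A - ?P" and ?N = "carrier R - Q"
  let ?LB = "localization ?B ?M" and ?L = "localization R ?N"
  let ?EB = "ext_prime ?B ?P" and ?E = "ext_prime R Q"
  note Ac = subringE[OF A]
  interpret Q: primeideal Q R by fact
  interpret B: cring ?B by (rule subring_cring[OF A])
  have "primeideal Q (R\<lparr>carrier := carrier R\<rparr>)" using Q by simp
  then have N: "submonoid ?N R" by (rule prime_of_subringD(7)[OF carrier_is_subring])
  have M': "submonoid ?M R" by (rule prime_of_subringD(7)[OF A P])
  then have M: "submonoid ?M ?B" unfolding submonoid_def by auto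
  interpret N: submonoid ?N R by (rule N)
  interpret M: submonoid ?M R by (rule M')
  interpret L: cring ?L by (rule localization_cring[OF N])
  interpret LB: cring ?LB by (rule B.localization_cring[OF M])
  have MN: "?M \<subseteq> ?N" using Ac(1) by blast
  have EB: "?EB = {fraction ?B ?M p s | p s. p \<in> ?P \<and> s \<in> ?M}" using B.ext_prime_eq(1)[OF P] by simp
  have E: "?E = {fraction R ?N p s | p s. p \<in> Q \<and> s \<in> ?N}" by (rule ext_prime_eq(1)[OF Q])
  have idl: "ideal ?E ?L" using ext_prime_eq(2)[OF Q] unfolding local_ring_at_def .
  then have sgE: "subgroup ?E (add_monoid ?L)"
    by (intro additive_subgroup.a_subgroup ideal.axioms)
  have LB_def: "local_ring_at ?B ?P = ?LB" and L_def: "local_ring_at R Q = ?L"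
    unfolding local_ring_at_def by simp_all
  have frac: "fraction R ?N a s \<in> carrier ?L" if "a \<in> carrier R" "s \<in> ?N" for a s
    using that unfolding localization_carrier[OF N] by blast
  have x1: "fraction R ?N x \<one> \<in> carrier ?L" using x N.one_closed by (rule frac)
  have "?E +>\<^bsub>?L\<^esub> fraction R ?N x \<one> \<in> carrier (residue_field R Q)"
    unfolding residue_field_def L_def FactRing_def A_RCOSETS_def' using x1 by auto
  then obtain C where C: "C \<in> carrier (residue_field ?B ?P)"
    "?E +>\<^bsub>?L\<^esub> fraction R ?N x \<one> = residual_map R Q C" using surj by blast
  then obtain y where y: "y \<in> carrier ?LB" "C = ?EB +>\<^bsub>?LB\<^esub> y"
    unfolding residue_field_def LB_def FactRing_def A_RCOSETS_def' by auto
  obtain r t where rt: "r \<in> A" "t \<in> ?M" "y = fraction ?B ?M r t"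
    using y(1) unfolding B.localization_carrier[OF M] by auto
  have rc: "r \<in> carrier R" "t \<in> carrier R" "t \<in> ?N" using rt Ac(1) MN by auto
  let ?z = "fraction R ?N r t"
  have zc: "?z \<in> carrier ?L" using rc by (intro frac)
  have loc: "loc_map R ?N (fraction ?B ?M a s) = fraction R ?N a s" if "a \<in> A" "s \<in> ?M" for a s
    by (rule loc_map_fraction[OF is_cring A N MN Diff_subset M that])
  have "?E +>\<^bsub>?L\<^esub> loc_map R ?N w = ?E +>\<^bsub>?L\<^esub> ?z" if w: "w \<in> C" for w
  proof -
    obtain p u where pu: "p \<in> ?P" "u \<in> ?M" "w = fraction ?B ?M p u \<oplus>\<^bsub>?LB\<^esub> y"
      using w unfolding y(2) a_r_coset_def' EB by auto
    have pA: "p \<in> A" "p \<in> Q" "p \<in> carrier R" "u \<in> ?N" "u \<in> A" using pu Ac(1) MN by auto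
    have "w = fraction ?B ?M (p \<otimes> t \<oplus> r \<otimes> u) (u \<otimes> t)"
      using fraction_add[OF B.is_cring M _ pu(2) _ rt(2), of p r] pA rt(1) unfolding pu(3) rt(3) by simp
    moreover have "p \<otimes> t \<oplus> r \<otimes> u \<in> A" using pA rt Ac(6,7) by blast
    ultimately have "loc_map R ?N w = fraction R ?N (p \<otimes> t \<oplus> r \<otimes> u) (u \<otimes> t)"
      using loc M.m_closed[OF pu(2) rt(2)] by simp
    also have "\<dots> = fraction R ?N p u \<oplus>\<^bsub>?L\<^esub> ?z"
      using fraction_add[OF is_cring N pA(3,4) rc(1,3)] by simp
    finally have "loc_map R ?N w \<in> ?E +>\<^bsub>?L\<^esub> ?z"
      unfolding a_r_coset_def' E using pA by blast
    then show ?thesis using L.a_repr_independence[OF _ zc sgE] by simp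
  qed
  moreover have "C \<noteq> {}"
    using M.one_closed Ac(2) unfolding y(2) a_r_coset_def' EB
    using prime_of_subringD(2)[OF A P] by blast
  ultimately have "(\<lambda>w. ?E +>\<^bsub>?L\<^esub> loc_map R ?N w) ` C = {?E +>\<^bsub>?L\<^esub> ?z}" by auto
  then have "?E +>\<^bsub>?L\<^esub> fraction R ?N x \<one> = ?E +>\<^bsub>?L\<^esub> ?z"
    using C(2) unfolding residual_map_def L_def by simp
  moreover have "fraction R ?N x \<one> \<in> ?E +>\<^bsub>?L\<^esub> fraction R ?N x \<one>"
    by (rule abelian_subgroup.a_rcos_self[OF abelian_subgroupI3[OF ideal.axioms(1)[OF idl]
      L.abelian_group_axioms] x1])
  ultimately have "fraction R ?N x \<one> \<in> ?E +>\<^bsub>?L\<^esub> ?z" by simp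
  then obtain q u where q: "q \<in> Q" "u \<in> ?N" "fraction R ?N x \<one> = fraction R ?N q u \<oplus>\<^bsub>?L\<^esub> ?z"
    unfolding a_r_coset_def' E by auto
  have qc: "q \<in> carrier R" "u \<in> carrier R" using q by auto
  have "fraction R ?N x \<one> = fraction R ?N (q \<otimes> t \<oplus> r \<otimes> u) (u \<otimes> t)"
    using q(3) fraction_add[OF is_cring N qc(1) q(2) rc(1,3)] by simp
  then obtain v where v: "v \<in> ?N" "v \<otimes> (x \<otimes> (u \<otimes> t)) = v \<otimes> ((q \<otimes> t \<oplus> r \<otimes> u) \<otimes> \<one>)"
    using fraction_eq_iff[OF N x N.one_closed _ N.m_closed[OF q(2) rc(3)]] qc rc by auto
  have vc: "v \<in> carrier R" using v(1) by blast
  have "(v \<otimes> u) \<otimes> (t \<otimes> x \<ominus> r) = v \<otimes> (x \<otimes> (u \<otimes> t)) \<ominus> v \<otimes> (r \<otimes> u)"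
    using vc qc rc x by algebra
  also have "\<dots> = (v \<otimes> t) \<otimes> q"
    unfolding v(2) using vc qc rc x by algebra
  also have "\<dots> \<in> Q" using q(1) vc rc by (intro Q.I_l_closed) auto
  finally have "t \<otimes> x \<ominus> r \<in> Q"
    using Q.I_prime[of "v \<otimes> u" "t \<otimes> x \<ominus> r"] N.m_closed[OF v(1) q(2)] rc x by auto
  then show ?thesis using rt by blast
qed

end

text \<open>Injectivity of \<open>Q \<mapsto> Q \<inter> R\<close> yields \<open>dominated\<close>: if no multiple of \<open>x\<close> lay in \<open>R - P\<close>, a prime over \<open>P\<close>
would contain \<open>x\<close>, and that prime is \<open>Q\<close>.\<close>

lemma subintegral_residually_trivial_prime:
  assumes S: "cring S" and R: "subring R S" and sub: "subintegral_extension S R"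
    and P: "primeideal P (sub_as_ring S R)"
  obtains Q where "residually_trivial_prime S R Q" "Q \<inter> R = P"
proof -
  interpret cring S by fact
  have bij: "bij_betw (\<lambda>Q. Q \<inter> R) (Spec S) (Spec (sub_as_ring S R))"
    and int: "integral_extension S R"
    and res: "\<And>Q. Q \<in> Spec S \<Longrightarrow> residual_map S Q
        \<in> ring_iso (residue_field (sub_as_ring S R) (Q \<inter> R)) (residue_field S Q)"
    using sub unfolding subintegral_extension_def by blast+
  have "P \<in> (\<lambda>Q. Q \<inter> R) ` Spec S" using bij P unfolding bij_betw_def Spec_def by simp
  then obtain Q where Q: "primeideal Q S" "Q \<inter> R = P" "Q \<in> Spec S" unfolding Spec_def by blast
  have "residually_trivial_prime S R Q"
  proof (intro residually_trivial_prime.intro residually_trivial_prime_axioms.intro)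
    show "cring S" "subring R S" "integral_extension S R" by fact+
    show "primeideal Q S" by fact
    fix x
    assume x: "x \<in> carrier S"
    have "carrier (residue_field S Q)
        \<subseteq> residual_map S Q ` carrier (residue_field (sub_as_ring S R) (Q \<inter> R))"
      using res[OF Q(3)] unfolding ring_iso_def bij_betw_def by auto
    then show "\<exists>t\<in>R - Q. \<exists>r\<in>R. t \<otimes>\<^bsub>S\<^esub> x \<ominus>\<^bsub>S\<^esub> r \<in> Q"
      using residual_surjective_imp_representative[OF R Q(1) _ _ x] P Q(2) by blast
  next
    fix x
    assume x: "x \<in> carrier S - Q"
    show "\<exists>y\<in>carrier S. y \<otimes>\<^bsub>S\<^esub> x \<in> R - Q"
    proof (rule ccontr)
      assume neg: "\<not> (\<exists>y\<in>carrier S. y \<otimes>\<^bsub>S\<^esub> x \<in> R - Q)"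
      have "\<exists>n. c [^]\<^bsub>S\<^esub> (n::nat) \<in> power_span R c n" if c: "c \<in> carrier S" for c
      proof -
        obtain p where "p \<noteq> []" "hd p = \<one>\<^bsub>S\<^esub>" "set p \<subseteq> R" "eval p c = \<zero>\<^bsub>S\<^esub>"
          using int c unfolding integral_extension_def by blast
        then show ?thesis using integral_imp_power_in_span[OF R c] by metis
      qed
      moreover have "y \<otimes>\<^bsub>S\<^esub> x \<notin> R - P" if "y \<in> carrier S" for y
        using neg that Q(2) by blast
      ultimately obtain Q' where Q': "primeideal Q' S" "x \<in> Q'" "Q' \<inter> R = P"
        using exists_prime_over_containing[OF R P] x by blast
      then have "Q' = Q"
        using bij Q unfolding bij_betw_def inj_on_def Spec_def by blast
      then show False using Q'(2) x by blast
    qed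
  qed
  then show ?thesis using that Q(2) by blast
qed

section \<open>The equivalence\<close>

theorem proposition4p2:
  fixes S :: "('a, 'm) ring_scheme" and R :: "'a set"
  assumes "cring S" and "subring R S" and "R \<subset> carrier S"
    and "subintegral_extension S R" and "FCP_extension S R"
  shows "distributive_extension S R \<longleftrightarrow> arithmetic_extension S R"
proof
  assume dist: "distributive_extension S R"
  show "arithmetic_extension S R"
    unfolding arithmetic_extension_iff_saturated[OF assms(1,2)]
  proof (intro ballI impI)
    fix P T U
    assume "P \<in> Spec (sub_as_ring S R)"
      and TU: "T \<in> intermediate_rings S R" "U \<in> intermediate_rings S R"
        "saturated S (R - P) T" "saturated S (R - P) U"
    then have "primeideal P (sub_as_ring S R)" unfolding Spec_def by simp
    then obtain Q where Q: "residually_trivial_prime S R Q" "Q \<inter> R = P"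
      by (rule subintegral_residually_trivial_prime[OF assms(1,2,4)])
    have "R - P = R - Q" using Q(2) by blast
    then show "T \<subseteq> U \<or> U \<subseteq> T"
      using residually_trivial_prime.distributive_saturated_comparable[OF Q(1) dist assms(5)] TU by simp
  qed
qed (rule arithmetic_imp_distributive[OF assms(1,2)])

end
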